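(* Let $\alpha,\beta,\gamma,\delta,\kappa$ be positive integers with $0<\gamma+\delta\le\beta+\kappa$ and $\kappa\le\min(\alpha,\gamma)$, and let $\bar k,\bar r$ be nonnegative integers. Then there is a $\mathbb{Z}_3\mathbb{Z}_9$-linear code $C$ of type $(\alpha,\beta;\gamma,\delta;\kappa)$ with $\ker(C)=\gamma+2\delta-\bar k$ and $\mathrm{rank}(C)=\gamma+2\delta+\bar r$ if and only if either $\bar k=\bar r=0$, or $\bar k\in\{1,\ldots,\delta\}$ and $$\bar r\in\left\{1,\ldots,\min\left(\beta-(\gamma-\kappa)-\delta,\ \binom{\bar k}{2}+\binom{\bar k+2}{3}\right)\right\}.$$
   Context: A $\mathbb{Z}_3\mathbb{Z}_9$-additive code $\mathcal{C}$ is a subgroup of $\mathbb{Z}_3^\alpha\times\mathbb{Z}_9^\beta$; as a group $\mathcal{C}\cong\mathbb{Z}_3^\gamma\times\mathbb{Z}_9^\delta$, and if $\kappa$ is the $\mathbb{Z}_3$-dimension of the projection onto the first $\alpha$ coordinates of the subcode of codewords of order dividing $3$, $\mathcal{C}$ has type $(\alpha,\beta;\gamma,\delta;\kappa)$. The Gray map $\phi:\mathbb{Z}_9\to\mathbb{Z}_3^3$ is $\phi(\theta)=\theta''(1,1,1)+\theta'(0,1,2)$ for $\theta=3\theta''+\theta'$, $\theta',\theta''\in\{0,1,2\}$, and $\Phi(\mathbf{x},\mathbf{y})=(\mathbf{x},\phi(y_1),\ldots,\phi(y_\beta))$. A $\mathbb{Z}_3\mathbb{Z}_9$-linear code of that type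 is $C=\Phi(\mathcal{C})$. $\mathrm{rank}(C)$ is the $\mathbb{Z}_3$-dimension of the linear span of $C$; $K(C)=\{\mathbf{x}\mid C+\mathbf{x}=C\}$ and $\ker(C)=\dim_{\mathbb{Z}_3}K(C)$. *)

theory Defs
  imports Main
begin

definition vecs :: "int \<Rightarrow> nat \<Rightarrow> int list set" where
  "vecs m n = {xs. length xs = n \<and> set xs \<subseteq> {0..m-1}}"

definition vadd :: "int \<Rightarrow> int list \<Rightarrow> int list \<Rightarrow> int list" where
  "vadd m xs ys = map2 (\<lambda>a b. (a + b) mod m) xs ys"

definition vneg :: "int \<Rightarrow> int list \<Rightarrow> int list" where
  "vneg m xs = map (\<lambda>a. (- a) mod m) xs"

definition vsmul :: "int \<Rightarrow> int \<Rightarrow> int list \<Rightarrow> int list" where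
  "vsmul m c xs = map (\<lambda>a. (c * a) mod m) xs"

definition vzero :: "nat \<Rightarrow> int list" where
  "vzero n = replicate n 0"

definition Z3Z9 :: "nat \<Rightarrow> nat \<Rightarrow> (int list \<times> int list) set" where
  "Z3Z9 a b = vecs 3 a \<times> vecs 9 b"

definition zadd :: "int list \<times> int list \<Rightarrow> int list \<times> int list \<Rightarrow> int list \<times> int list" where
  "zadd u v = (vadd 3 (fst u) (fst v), vadd 9 (snd u) (snd v))"

definition zneg :: "int list \<times> int list \<Rightarrow> int list \<times> int list" where
  "zneg u = (vneg 3 (fst u), vneg 9 (snd u))"

definition additive_code :: "nat \<Rightarrow> nat \<Rightarrow> (int list \<times> int list) set \<Rightarrow> bool" where
  "additive_code a b C \<longleftrightarrow> C \<subseteq> Z3Z9 a b \<and> (vzero a, vzero b) \<in> C \<and>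
     (\<forall>u\<in>C. \<forall>v\<in>C. zadd u v \<in> C) \<and> (\<forall>u\<in>C. zneg u \<in> C)"

inductive_set span3 :: "nat \<Rightarrow> int list set \<Rightarrow> int list set" for n B where
  zero: "vzero n \<in> span3 n B"
| step: "\<lbrakk>v \<in> span3 n B; s \<in> B; c \<in> {0..2}\<rbrakk> \<Longrightarrow> vadd 3 (vsmul 3 c s) v \<in> span3 n B"

definition dim3 :: "nat \<Rightarrow> int list set \<Rightarrow> nat" where
  "dim3 n V = (LEAST d. \<exists>B. finite B \<and> B \<subseteq> V \<and> card B = d \<and> span3 n B = V)"

definition has_type :: "(int list \<times> int list) set \<Rightarrow> nat \<Rightarrow> nat \<Rightarrow> nat \<Rightarrow> nat \<Rightarrow> nat \<Rightarrow> bool" where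
  "has_type C a b g d k \<longleftrightarrow> additive_code a b C \<and>
     (\<exists>f. bij_betw f (Z3Z9 g d) C \<and>
          (\<forall>u\<in>Z3Z9 g d. \<forall>v\<in>Z3Z9 g d. f (zadd u v) = zadd (f u) (f v))) \<and>
     k = dim3 a (fst ` {u \<in> C. zadd u (zadd u u) = (vzero a, vzero b)})"

definition gray :: "int \<Rightarrow> int list" where
  "gray t = (let t2 = t div 3; t1 = t mod 3 in [t2 mod 3, (t2 + t1) mod 3, (t2 + 2 * t1) mod 3])"

definition Gray :: "int list \<times> int list \<Rightarrow> int list" where
  "Gray u = fst u @ concat (map gray (snd u))"

definition rank3 :: "nat \<Rightarrow> int list set \<Rightarrow> nat" where
  "rank3 n C = dim3 n (span3 n C)"

definition Kern3 :: "nat \<Rightarrow> int list set \<Rightarrow> int list set" where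
  "Kern3 n C = {x \<in> vecs 3 n. (\<lambda>c. vadd 3 c x) ` C = C}"

definition ker3 :: "nat \<Rightarrow> int list set \<Rightarrow> nat" where
  "ker3 n C = dim3 n (Kern3 n C)"

end

theory Submission
  imports Defs Complex_Main "HOL-Library.Numeral_Type" "HOL-Library.Function_Algebras"
    "HOL-Library.Product_Plus" "HOL-Library.FuncSet"
begin

text \<open>
  Write a codeword as \<open>(x, 3 q + r)\<close> with digit vectors \<open>q, r\<close> over \<open>\<int>\<^sub>3\<close>. In these coordinates the Gray
  map is linear, and the only non-linearity of the group law is the carry polynomial
  \<open>c(r, s) = - (r\<^sup>2 s + r s\<^sup>2 + r s)\<close> added to \<open>q\<close>. Let \<open>R\<close> be the space of residues \<open>r\<close> of the code and
  \<open>D \<supseteq> R\<close> the space of all \<open>q\<close> with \<open>(0, 3 q)\<close> in the code; they have dimensions \<open>\<delta>\<close> and \<open>\<gamma> + \<delta> - \<kappa>\<close>. Then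
  \<open>kb\<close> is the codimension in \<open>R\<close> of \<open>{r. \<forall>s\<in>R. c(s, r) \<in> D}\<close>, and \<open>rb\<close> is the dimension modulo \<open>D\<close> of the
  span of all carries. Modulo \<open>D\<close> the carries are combinations of the products of two or three out
  of \<open>kb\<close> residues, where \<open>w\<^sup>3 = w \<in> D\<close>; this gives the bound on \<open>rb\<close>.

  Conversely, let the residues be the rows of an identity matrix extended by columns \<open>h\<close>. Each
  column contributes the function \<open>(a, b) \<mapsto> c(h a, h b) - h c(a, b)\<close>, these functions span a space of
  the maximal dimension, and the single column \<open>(2, \<dots>, 2)\<close> already makes the kernel as small as
  possible. Enlarging this column to an independent family of size \<open>rb\<close> realises every value.
\<close>

section \<open>Linear algebra over the field with three elements\<close>

lemma F3_cases: obtains "x = (0::3)" | "x = 1" | "x = 2"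
proof (cases x)
  case (of_int z)
  then have "z = 0 \<or> z = 1 \<or> z = 2" by auto
  with of_int that show thesis by auto
qed

lemma of_int_F3_eq: "(of_int a :: 3) = of_int b \<longleftrightarrow> a mod 3 = b mod 3"
proof
  assume "(of_int a :: 3) = of_int b"
  then have "Rep_bit1 (Abs_bit1 (a mod 3) :: 3) = Rep_bit1 (Abs_bit1 (b mod 3) :: 3)"
    by (simp add: bit1.of_int_eq Abs_bit1'_def)
  then show "a mod 3 = b mod 3"
    by (simp add: Abs_bit1_inverse)
next
  assume "a mod 3 = b mod 3"
  then show "(of_int a :: 3) = of_int b" by (simp add: bit1.of_int_eq)
qed

lemma of_int_F3_mod:
  assumes "3 dvd m" shows "(of_int (a mod m) :: 3) = of_int a"
  using assms by (simp add: of_int_F3_eq mod_mod_cancel)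

text \<open>Fermat's little theorem for the prime 3.\<close>

lemma F3_cube: "(x::3) * x * x = x"
  by (cases x rule: F3_cases) simp_all

lemma F3_triple: "(x::3) + x + x = 0"
  by (cases x rule: F3_cases) simp_all

lemma F3_unit: "(x::3) \<noteq> 0 \<Longrightarrow> x * x = 1"
  by (cases x rule: F3_cases) simp_all

text \<open>Dimensions are measured by cardinalities from here on: a space of dimension n over the
  field with three elements has \<open>3 ^ n\<close> elements.\<close>

interpretation fs: module "\<lambda>(c::3) (f::'x \<Rightarrow> 3). (\<lambda>i. c * f i)"
  by unfold_locales (auto simp: algebra_simps plus_fun_def)

lemma fun3_cube: "(f::'x \<Rightarrow> 3) * f * f = f"
  by (auto simp: times_fun_def F3_cube)

lemma fun3_triple: "(f::'x \<Rightarrow> 3) + f + f = 0"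
  by (rule ext) (simp only: plus_fun_def zero_fun_def F3_triple)

lemma fun3_neg: "- (f::'x \<Rightarrow> 3) = f + f"
  using fun3_triple[of f] by (metis add.commute minus_unique)

text \<open>Every scalar is 0, 1 or 1 + 1, so closure under scaling follows from closure under
  addition.\<close>

lemma subspace_iff:
  "fs.subspace (V :: ('x \<Rightarrow> 3) set) \<longleftrightarrow> 0 \<in> V \<and> (\<forall>x\<in>V. \<forall>y\<in>V. x + y \<in> V)"
proof -
  have "(\<lambda>i. c * f i) \<in> V" if V: "0 \<in> V" "\<forall>x\<in>V. \<forall>y\<in>V. x + y \<in> V" and f: "f \<in> V" for c :: 3 and f
  proof (cases c rule: F3_cases)
    case 1 then show ?thesis using V by (simp add: zero_fun_def)
  next
    case 2 then show ?thesis using f by simp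
  next
    case 3
    have "(\<lambda>i. c * f i) = f + f" by (auto simp: 3 plus_fun_def)
    then show ?thesis using V(2) f by (simp only:)
  qed
  then show ?thesis unfolding fs.subspace_def by blast
qed

text \<open>In characteristic 3 doubling an element negates its image, so doubles serve as inverses.\<close>

lemma card_hom:
  fixes f :: "'g \<Rightarrow> 'x \<Rightarrow> 3"
  assumes fin: "finite A"
    and closed: "\<And>x y. x \<in> A \<Longrightarrow> y \<in> A \<Longrightarrow> opr x y \<in> A"
    and canc: "\<And>a x y. a \<in> A \<Longrightarrow> x \<in> A \<Longrightarrow> y \<in> A \<Longrightarrow> opr a x = opr a y \<Longrightarrow> x = y"
    and hom: "\<And>x y. x \<in> A \<Longrightarrow> y \<in> A \<Longrightarrow> f (opr x y) = f x + f y"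
  shows "card A = card {x\<in>A. f x = 0} * card (f ` A)"
proof -
  let ?K = "{x\<in>A. f x = 0}"
  have fib: "card {x\<in>A. f x = b} = card ?K" if "b \<in> f ` A" for b
  proof (rule antisym)
    from that obtain a where a: "a \<in> A" "f a = b" by auto
    have d: "opr a a \<in> A" "f (opr a a) = - b"
      using a closed hom by (auto simp: fun3_neg)
    show "card {x\<in>A. f x = b} \<le> card ?K"
    proof (rule card_inj_on_le[of "opr (opr a a)"])
      show "inj_on (opr (opr a a)) {x\<in>A. f x = b}" using d canc by (auto intro!: inj_onI)
      show "opr (opr a a) ` {x\<in>A. f x = b} \<subseteq> ?K" using d closed hom by auto
    qed (use fin in auto)
    show "card ?K \<le> card {x\<in>A. f x = b}"
    proof (rule card_inj_on_le[of "opr a"])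
      show "inj_on (opr a) ?K" using a canc by (auto intro!: inj_onI)
      show "opr a ` ?K \<subseteq> {x\<in>A. f x = b}" using a closed hom by auto
    qed (use fin in auto)
  qed
  have "card A = (\<Sum>b\<in>f ` A. card {x\<in>A. f x = b})"
    using sum.group[of A "f ` A" f "\<lambda>_. 1::nat"] fin by simp
  also have "\<dots> = card ?K * card (f ` A)" using fib by simp
  finally show ?thesis .
qed

lemma card_hom_subspace:
  fixes f :: "('y \<Rightarrow> 3) \<Rightarrow> 'x \<Rightarrow> 3"
  assumes "finite A" "fs.subspace A" "\<And>x y. f (x + y) = f x + f y"
  shows "card A = card {x\<in>A. f x = 0} * card (f ` A)"
  using assms by (intro card_hom[where opr = "(+)"]) (auto simp: fs.subspace_add)

section \<open>Spans, bases and dimension by counting\<close>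

lemma span_insert_eq_image:
  "fs.span (insert a S) = (\<lambda>(c, v). (\<lambda>i. c * a i) + v) ` (UNIV \<times> fs.span S)"
proof (intro equalityI subsetI)
  fix x assume "x \<in> fs.span (insert a S)"
  then obtain k where "x - (\<lambda>i. k * a i) \<in> fs.span S" by (auto simp: fs.span_insert)
  then show "x \<in> (\<lambda>(c, v). (\<lambda>i. c * a i) + v) ` (UNIV \<times> fs.span S)"
    by (intro image_eqI[of _ _ "(k, x - (\<lambda>i. k * a i))"]) auto
next
  fix x assume "x \<in> (\<lambda>(c, v). (\<lambda>i. c * a i) + v) ` (UNIV \<times> fs.span S)"
  then obtain c v where "x = (\<lambda>i. c * a i) + v" "v \<in> fs.span S" by auto
  then show "x \<in> fs.span (insert a S)" by (auto simp: fs.span_insert intro!: exI[of _ c])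
qed

lemma finite_span_insert: "finite (fs.span S) \<Longrightarrow> finite (fs.span (insert a S))"
  by (simp add: span_insert_eq_image)

lemma card_span_insert_le:
  assumes "finite (fs.span S)" shows "card (fs.span (insert a S)) \<le> 3 * card (fs.span S)"
proof -
  have "card (fs.span (insert a S)) \<le> card ((UNIV::3 set) \<times> fs.span S)"
    unfolding span_insert_eq_image using assms by (intro card_image_le) auto
  then show ?thesis by (simp add: card_cartesian_product)
qed

lemma card_span_insert:
  assumes "finite (fs.span S)" "a \<notin> fs.span S"
  shows "card (fs.span (insert a S)) = 3 * card (fs.span S)"
proof -
  have "inj_on (\<lambda>(c, v). (\<lambda>i. c * a i) + v) ((UNIV::3 set) \<times> fs.span S)"
  proof (rule inj_onI, clarify)
    fix c v d w assume v: "v \<in> fs.span S" and w: "w \<in> fs.span S"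
      and eq: "(\<lambda>i. c * a i) + v = (\<lambda>i. d * a i) + w"
    have "(\<lambda>i. (c - d) * a i) = (\<lambda>i. c * a i) - (\<lambda>i. d * a i)"
      by (auto simp: algebra_simps)
    also have "\<dots> = w - v" using eq by (simp add: algebra_simps)
    finally have "(\<lambda>i. (c - d) * a i) \<in> fs.span S" using v w by (simp add: fs.span_diff)
    \<comment> \<open>A nonzero scalar is its own inverse, so scaling by \<open>c - d\<close> a
      second time would put \<open>a\<close> itself into the span.\<close>
    then have *: "(\<lambda>i. (c - d) * ((c - d) * a i)) \<in> fs.span S" by (rule fs.span_scale)
    have "c = d"
    proof (rule ccontr)
      assume "c \<noteq> d"
      then have "(\<lambda>i. (c - d) * ((c - d) * a i)) = a"
        using F3_unit[of "c - d"] by (simp add: mult.assoc[symmetric])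
      then show False using * assms(2) by simp
    qed
    then show "c = d \<and> v = w" using eq by simp
  qed
  then show ?thesis
    unfolding span_insert_eq_image by (subst card_image) (auto simp: card_cartesian_product)
qed

lemma card_span_Un_le:
  assumes "finite X" "finite (fs.span S)"
  shows "finite (fs.span (S \<union> X)) \<and> card (fs.span (S \<union> X)) \<le> card (fs.span S) * 3 ^ card X"
  using assms(1)
proof (induction X rule: finite_induct)
  case empty then show ?case using assms by simp
next
  case (insert x X)
  then show ?case using card_span_insert_le[of "S \<union> X" x] by (auto simp: finite_span_insert)
qed

lemma card_span_le: "finite B \<Longrightarrow> card (fs.span B) \<le> 3 ^ card B"
  using card_span_Un_le[of B "{}"] by (simp add: fs.span_empty)

text \<open>Basis extension in counting form: the equation for \<open>card V\<close> says that
  \<open>W\<close> is independent modulo \<open>U\<close>. The induction is on the number of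
  elements of \<open>V\<close> outside \<open>U\<close>; adjoining one of them triples the
  subspace.\<close>

lemma subspace_extend:
  assumes "finite V" "fs.subspace V" "U \<subseteq> V" "fs.subspace U"
  shows "\<exists>W. finite W \<and> W \<subseteq> V \<and> fs.span (U \<union> W) = V \<and> card V = card U * 3 ^ card W"
  using assms(3,4)
proof (induction "card (V - U)" arbitrary: U rule: less_induct)
  case less
  have finU: "finite U" using less.prems assms(1) finite_subset by blast
  have spU: "fs.span U = U" using less.prems by simp
  show ?case
  proof (cases "U = V")
    case True then show ?thesis using spU by (intro exI[of _ "{}"]) auto
  next
    case False
    then obtain a where a: "a \<in> V" "a \<notin> U" using less.prems by auto
    let ?U = "fs.span (insert a U)"
    have U': "?U \<subseteq> V" using a less.prems assms(2) by (intro fs.span_minimal) auto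
    have aU: "insert a U \<subseteq> ?U" by (rule fs.span_superset)
    have "card (V - ?U) < card (V - U)"
      using a aU assms(1) by (intro psubset_card_mono) auto
    from less.hyps[OF this U' fs.subspace_span] obtain W where
      W: "finite W" "W \<subseteq> V" "fs.span (?U \<union> W) = V" "card V = card ?U * 3 ^ card W" by auto
    have cU: "card ?U = 3 * card U" using card_span_insert[of U a] a finU spU by simp
    have sp: "fs.span (U \<union> insert a W) = V"
    proof
      show "fs.span (U \<union> insert a W) \<subseteq> V"
        using a W less.prems assms(2) by (intro fs.span_minimal) auto
      have "?U \<union> W \<subseteq> fs.span (U \<union> insert a W)"
        using fs.span_mono[of "insert a U" "U \<union> insert a W"] fs.span_superset[of "U \<union> insert a W"] by auto
      then show "V \<subseteq> fs.span (U \<union> insert a W)"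
        using W(3) fs.span_minimal[OF _ fs.subspace_span] by metis
    qed
    \<comment> \<open>Otherwise \<open>W - {a}\<close> would already span \<open>V\<close> over
      \<open>?U\<close>, which is too few generators for the size of \<open>V\<close>.\<close>
    have "a \<notin> W"
    proof
      assume "a \<in> W"
      then have "?U \<union> W = ?U \<union> (W - {a})" using aU by auto
      then have "V = fs.span (?U \<union> (W - {a}))" using W(3) by simp
      then have "card V \<le> card ?U * 3 ^ card (W - {a})"
        using card_span_Un_le[of "W - {a}" ?U] W(1) finite_subset[OF U' assms(1)]
        by (simp add: fs.span_span)
      also have "\<dots> < card ?U * 3 ^ card W"
      proof (rule mult_less_mono2)
        show "(3::nat) ^ card (W - {a}) < 3 ^ card W"
          using card_Diff1_less[OF W(1) \<open>a \<in> W\<close>] by simp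
        show "0 < card ?U"
          using finite_subset[OF U' assms(1)] aU by (auto simp: card_gt_0_iff)
      qed
      finally show False using W(4) by simp
    qed
    then have "card V = card U * 3 ^ card (insert a W)" using W cU by simp
    then show ?thesis using W a sp by (intro exI[of _ "insert a W"]) auto
  qed
qed

text \<open>The exponent has the shape of \<open>dim3\<close>, for functions in place of lists. A
  basis attains the minimum, and fewer generators span too few elements.\<close>

lemma LEAST_span_card:
  assumes "finite V" "fs.subspace V"
  shows "card (V :: ('a \<Rightarrow> 3) set) = 3 ^ (LEAST d. \<exists>B. finite B \<and> B \<subseteq> V \<and> card B = d \<and> fs.span B = V)"
proof -
  obtain W where W: "finite W" "W \<subseteq> V" "fs.span ({0} \<union> W) = V" "card V = card {0 :: 'a \<Rightarrow> 3} * 3 ^ card W"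
    using subspace_extend[OF assms, of "{0}"] fs.subspace_0[OF assms(2)] fs.subspace_single_0 by auto
  have sW: "fs.span W = V"
    using W(3) fs.span_insert[of 0 W] by (simp flip: zero_fun_def)
  have "(LEAST d. \<exists>B. finite B \<and> B \<subseteq> V \<and> card B = d \<and> fs.span B = V) = card W"
  proof (rule Least_equality)
    fix d assume "\<exists>B. finite B \<and> B \<subseteq> V \<and> card B = d \<and> fs.span B = V"
    then obtain B where "finite B" "card B = d" "fs.span B = V" by auto
    then have "(3::nat) ^ card W \<le> 3 ^ d" using card_span_le[of B] W by auto
    then show "card W \<le> d" by simp
  qed (use W sW in auto)
  then show ?thesis using W by simp
qed

section \<open>Codes in digit coordinates\<close>

text \<open>Vectors of length n are functions on all naturals that vanish from n on, so that all
  lengths share one type.\<close>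

definition supp_space :: "nat \<Rightarrow> (nat \<Rightarrow> 3) set" where
  "supp_space n = {f. \<forall>i\<ge>n. f i = 0}"

lemma subspace_supp_space [simp]: "fs.subspace (supp_space n)"
  by (auto simp: subspace_iff supp_space_def)

lemma finite_card_supp_space: "finite (supp_space n) \<and> card (supp_space n) = 3 ^ n"
proof -
  have b: "bij_betw (\<lambda>f. restrict f {..<n}) (supp_space n) ({..<n} \<rightarrow>\<^sub>E (UNIV :: 3 set))"
  proof (rule bij_betwI[where g = "\<lambda>f i. if i < n then f i else 0"])
    show "(\<lambda>f. restrict f {..<n}) \<in> supp_space n \<rightarrow> ({..<n} \<rightarrow>\<^sub>E (UNIV :: 3 set))" by auto
    show "(\<lambda>f i. if i < n then f i else 0) \<in> ({..<n} \<rightarrow>\<^sub>E (UNIV :: 3 set)) \<rightarrow> supp_space n"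
      by (auto simp: supp_space_def)
    show "(\<lambda>i. if i < n then restrict f {..<n} i else 0) = f" if "f \<in> supp_space n" for f
      using that by (auto simp: supp_space_def)
    show "restrict (\<lambda>i. if i < n then f i else 0) {..<n} = f" if "f \<in> {..<n} \<rightarrow>\<^sub>E (UNIV :: 3 set)" for f
      using that by (auto simp: restrict_def PiE_def extensional_def)
  qed
  have "finite ({..<n} \<rightarrow>\<^sub>E (UNIV :: 3 set))" by (auto intro: finite_PiE)
  moreover have "card ({..<n} \<rightarrow>\<^sub>E (UNIV :: 3 set)) = 3 ^ n" by (simp add: card_PiE)
  ultimately show ?thesis using b bij_betw_finite bij_betw_same_card by metis
qed

lemmas finite_supp_space = finite_card_supp_space[THEN conjunct1]
lemmas card_supp_space = finite_card_supp_space[THEN conjunct2]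

text \<open>The carry when adding two base-3 digits from \<open>{0, 1, 2}\<close>, as a polynomial over the field
  with three elements.\<close>

definition carry :: "'a::comm_ring_1 \<Rightarrow> 'a \<Rightarrow> 'a" where
  "carry r s = - (r * r * s + r * s * s + r * s)"

lemma carry_fun_apply: "carry f g i = carry (f i) (g i)" for f g :: "'x \<Rightarrow> 'a::comm_ring_1"
  by (simp add: carry_def)

text \<open>Associativity of addition with carry. As a polynomial identity it also holds for
  functions with pointwise product.\<close>

lemma carry_cocycle: "carry r s + carry (r + s) t = carry s t + carry r (s + t)"
  by (simp add: carry_def algebra_simps)

lemma carry_commute: "carry r s = carry s r"
  by (simp add: carry_def algebra_simps)

lemma carry_0 [simp]: "carry 0 r = 0" "carry r 0 = 0"
  by (simp_all add: carry_def)

text \<open>Adding three copies of a digit x gives 3 x: the last digit is 0 and the total carry is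
  x.\<close>

lemma carry_double: "carry (x::3) x + carry (x + x) x = x"
  by (cases x rule: F3_cases) (simp_all add: carry_def)

lemma carry_supp_space: "r \<in> supp_space n \<Longrightarrow> carry r s \<in> supp_space n"
  by (auto simp: supp_space_def carry_fun_apply)

type_synonym triple3 = "(nat \<Rightarrow> 3) \<times> (nat \<Rightarrow> 3) \<times> (nat \<Rightarrow> 3)"

text \<open>The group law of \<open>\<int>\<^sub>3\<^sup>a \<times> \<int>\<^sub>9\<^sup>b\<close> in coordinates \<open>(x, q, r)\<close>, where the second component is
  \<open>3 q + r\<close>.\<close>

definition twist :: "triple3 \<Rightarrow> triple3 \<Rightarrow> triple3" where
  "twist u v = (fst u + fst v, fst (snd u) + fst (snd v) + carry (snd (snd u)) (snd (snd v)),
     snd (snd u) + snd (snd v))"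

lemma twist_simp [simp]: "twist (x, q, r) (x', q', r') = (x + x', q + q' + carry r r', r + r')"
  by (simp add: twist_def)

lemma twist_cancel: "twist u v = twist u w \<Longrightarrow> v = w"
  by (cases u; cases v; cases w) auto

text \<open>In the second component this is 3 (3 q + r) = 3 r modulo 9.\<close>

lemma triple_twist: "twist (twist (x, q, r) (x, q, r)) (x, q, r) = (0, r, 0)"
proof -
  have "carry r r + carry (r + r) r = r"
    by (rule ext) (simp only: plus_fun_apply carry_fun_apply carry_double)
  moreover have "q + q + carry r r + q + carry (r + r) r = (q + q + q) + (carry r r + carry (r + r) r)"
    by (simp only: ac_simps)
  ultimately show ?thesis by (simp only: twist_simp fun3_triple add_0)
qed

section \<open>The three layers of a code and their sizes\<close>

definition low_part :: "triple3 set \<Rightarrow> (nat \<Rightarrow> 3) set" where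
  "low_part M = {q. (0, q, 0) \<in> M}"

definition first_part :: "triple3 set \<Rightarrow> (nat \<Rightarrow> 3) set" where
  "first_part M = {x. \<exists>q. (x, q, 0) \<in> M}"

definition residue_part :: "triple3 set \<Rightarrow> (nat \<Rightarrow> 3) set" where
  "residue_part M = {r. \<exists>x q. (x, q, r) \<in> M}"

text \<open>On words with residue 0 the first component is additive for \<open>twist\<close>, with
  image \<open>first_part\<close> and kernel a copy of \<open>low_part\<close>.\<close>

lemma card_torsion:
  assumes "finite M" and closed: "\<And>u v. u \<in> M \<Longrightarrow> v \<in> M \<Longrightarrow> twist u v \<in> M"
  shows "card {u\<in>M. snd (snd u) = 0} = card (low_part M) * card (first_part M)"
proof -
  let ?T = "{u\<in>M. snd (snd u) = 0}"
  have "card ?T = card {u\<in>?T. fst u = 0} * card (fst ` ?T)"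
    using assms by (intro card_hom[where opr = twist]) (auto dest: twist_cancel)
  moreover have "fst ` ?T = first_part M" by (force simp: first_part_def)
  moreover have "{u\<in>?T. fst u = 0} = (\<lambda>q. (0, q, 0) :: triple3) ` low_part M" by (auto simp: low_part_def)
  moreover have "card ((\<lambda>q. (0, q, 0) :: triple3) ` low_part M) = card (low_part M)"
    by (intro card_image inj_onI) auto
  ultimately show ?thesis by (simp only: )
qed

text \<open>The residue is additive for \<open>twist\<close>; its kernel is counted by
  \<open>card_torsion\<close>.\<close>

lemma card_twisted:
  assumes "finite M" and closed: "\<And>u v. u \<in> M \<Longrightarrow> v \<in> M \<Longrightarrow> twist u v \<in> M"
  shows "card M = card (low_part M) * card (first_part M) * card (residue_part M)"
proof -
  have "card M = card {u\<in>M. snd (snd u) = 0} * card ((\<lambda>u. snd (snd u)) ` M)"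
    using assms by (intro card_hom[where opr = twist]) (auto dest: twist_cancel)
  moreover have "(\<lambda>u. snd (snd u)) ` M = residue_part M" by (force simp: residue_part_def)
  ultimately show ?thesis using card_torsion[OF assms] by simp
qed

section \<open>The Gray map in digit coordinates\<close>

text \<open>Position \<open>a + 3 * j + m\<close> with m < 3 carries q_j + m r_j, which is entry m
  of q_j (1,1,1) + r_j (0,1,2). The map is additive for the componentwise sum, whereas the code is
  closed under \<open>twist\<close>.\<close>

definition gray_embed :: "nat \<Rightarrow> nat \<Rightarrow> triple3 \<Rightarrow> nat \<Rightarrow> 3" where
  "gray_embed a b u i = (if i < a then fst u i
     else if i < a + 3 * b then fst (snd u) ((i - a) div 3) +
       of_nat ((i - a) mod 3) * snd (snd u) ((i - a) div 3)
     else 0)"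

lemma gray_embed_add: "gray_embed a b (u + v) = gray_embed a b u + gray_embed a b v"
  by (rule ext) (simp add: gray_embed_def fst_add snd_add algebra_simps)

lemma gray_embed_zero: "gray_embed a b 0 = 0"
  by (rule ext) (simp add: gray_embed_def)

lemma gray_embed_supp: "gray_embed a b u \<in> supp_space (a + 3 * b)"
  by (auto simp: supp_space_def gray_embed_def)

text \<open>In each block of three the entry m = 0 returns q, and the entry m = 1 then returns
  r.\<close>

lemma inj_on_gray_embed:
  "inj_on (gray_embed a b) (supp_space a \<times> supp_space b \<times> supp_space b)"
proof (intro inj_onI)
  fix u v :: triple3
  assume uv: "u \<in> supp_space a \<times> supp_space b \<times> supp_space b"
    "v \<in> supp_space a \<times> supp_space b \<times> supp_space b" "gray_embed a b u = gray_embed a b v"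
  obtain x q r x' q' r' where u: "u = (x, q, r)" and v: "v = (x', q', r')" by (cases u; cases v)
  with uv have sx: "x \<in> supp_space a" "x' \<in> supp_space a"
    and sq: "q \<in> supp_space b" "q' \<in> supp_space b" and sr: "r \<in> supp_space b" "r' \<in> supp_space b"
    and eq: "gray_embed a b (x, q, r) = gray_embed a b (x', q', r')" by auto
  have "x i = x' i" for i
    using fun_cong[OF eq, of i] sx by (cases "i < a") (auto simp: gray_embed_def supp_space_def)
  moreover have q: "q j = q' j" for j
    using fun_cong[OF eq, of "a + 3 * j"] sq by (cases "j < b") (auto simp: gray_embed_def supp_space_def)
  moreover have "r j = r' j" for j
  proof (cases "j < b")
    case True
    have "(3 * j + 1) div 3 = j" "(3 * j + 1) mod 3 = 1" by presburger+
    then show ?thesis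
      using fun_cong[OF eq, of "a + (3 * j + 1)"] True q[of j]
      by (simp add: gray_embed_def del: One_nat_def)
  qed (use sr in \<open>auto simp: supp_space_def\<close>)
  ultimately show "u = v" by (auto simp: u v)
qed

section \<open>Kernel and linear span of the Gray image\<close>

locale twisted_code =
  fixes a b :: nat and M :: "triple3 set"
  assumes sub: "M \<subseteq> supp_space a \<times> supp_space b \<times> supp_space b"
    and zero: "0 \<in> M"
    and closed: "u \<in> M \<Longrightarrow> v \<in> M \<Longrightarrow> twist u v \<in> M"
begin

abbreviation "D \<equiv> low_part M"
abbreviation "A \<equiv> first_part M"
abbreviation "R \<equiv> residue_part M"

text \<open>The kernel of the Gray image turns out to be the image of \<open>kernel_code\<close>,
  the words with residue in \<open>KR\<close>, and its linear span the image of
  \<open>span_code\<close>, where \<open>S\<close> replaces \<open>D\<close> as the low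
  layer.\<close>

definition "KR = {r\<in>R. \<forall>s\<in>R. carry s r \<in> D}"
definition "carries = {carry r s | r s. r \<in> R \<and> s \<in> R}"
definition "S = fs.span (D \<union> carries)"
definition "kernel_code = {u\<in>M. snd (snd u) \<in> KR}"
definition "span_code = {(x, q + s, r) | x q r s. (x, q, r) \<in> M \<and> s \<in> S}"

lemma finite_ambient: "finite (supp_space a \<times> supp_space b \<times> supp_space b)"
  by (simp add: finite_supp_space)

lemma finite_M: "finite M"
  using sub finite_ambient finite_subset by blast

lemma D_supp: "D \<subseteq> supp_space b" and R_supp: "R \<subseteq> supp_space b"
  using sub by (auto simp: low_part_def residue_part_def)

lemma subspace_D: "fs.subspace D"
  unfolding subspace_iff using zero closed[of "(0, q, 0)" "(0, q', 0)" for q q']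
  by (auto simp: low_part_def zero_prod_def)

lemma subspace_A: "fs.subspace A"
  unfolding subspace_iff
proof (intro conjI ballI)
  show "0 \<in> A" using zero by (auto simp: first_part_def zero_prod_def)
  fix x x' assume "x \<in> A" "x' \<in> A"
  then obtain q q' where "(x, q, 0) \<in> M" "(x', q', 0) \<in> M" by (auto simp: first_part_def)
  from closed[OF this] show "x + x' \<in> A" by (auto simp: first_part_def)
qed

lemma subspace_R: "fs.subspace R"
  unfolding subspace_iff using zero closed[of "(x, q, r)" "(x', q', r')" for x q r x' q' r']
  by (fastforce simp: residue_part_def zero_prod_def)

lemma finite_D: "finite D" and finite_R: "finite R"
  using D_supp R_supp finite_supp_space finite_subset by blast+

text \<open>Tripling a codeword with residue r gives \<open>(0, r, 0)\<close>.\<close>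

lemma R_subset_D: "R \<subseteq> D"
proof
  fix r assume "r \<in> R"
  then obtain x q where m: "(x, q, r) \<in> M" by (auto simp: residue_part_def)
  from closed[OF closed[OF m m] m] show "r \<in> D" by (simp only: triple_twist low_part_def mem_Collect_eq)
qed

lemma translate_D:
  assumes "(x, q, r) \<in> M" "d \<in> D" shows "(x, q + d, r) \<in> M"
  using closed[OF assms(1), of "(0, d, 0)"] assms(2) by (simp add: low_part_def)

text \<open>Twice the first word plus the second is \<open>(0, r + z, 0)\<close>, because tripling
  the first gives \<open>(0, r, 0)\<close>. The summand r is removed beforehand, which is possible
  as r lies in \<open>D\<close>.\<close>

lemma difference_D:
  assumes m: "(x, q, r) \<in> M" and m': "(x, q + z, r) \<in> M" shows "z \<in> D"
proof -
  have "r \<in> D" using R_subset_D m by (auto simp: residue_part_def)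
  then have "- r \<in> D" using fs.subspace_neg subspace_D by blast
  from translate_D[OF closed[OF m m, unfolded twist_simp] this]
  have "(x + x, q + q + carry r r + - r, r + r) \<in> M" .
  from closed[OF this m']
  have *: "(x + x + x, q + q + carry r r + - r + (q + z) + carry (r + r) r, r + r + r) \<in> M" by simp
  have "q + q + carry r r + q + carry (r + r) r = r"
    using triple_twist[of 0 q r] by simp
  then have "q + q + carry r r + - r + (q + z) + carry (r + r) r = z"
    by (simp add: algebra_simps)
  with * show ?thesis by (simp only: fun3_triple low_part_def mem_Collect_eq)
qed

text \<open>The cocycle identity turns the difference into a difference of two carries with k, and
  both lie in \<open>D\<close>.\<close>

lemma carry_add_mod_D:
  assumes "r \<in> R" "s \<in> R" "k \<in> KR" shows "carry (r + k) s - carry r s \<in> D"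
proof -
  have k: "k \<in> R" "\<And>t. t \<in> R \<Longrightarrow> carry t k \<in> D" using assms(3) by (auto simp: KR_def)
  have "carry k r + carry (k + r) s = carry r s + carry k (r + s)" by (rule carry_cocycle)
  then have "carry (r + k) s - carry r s = carry (r + s) k - carry r k"
    by (simp add: carry_commute[of k] algebra_simps)
  then show ?thesis
    using k assms subspace_D subspace_R by (simp add: fs.subspace_diff fs.subspace_add)
qed

lemma subspace_KR: "fs.subspace KR"
proof -
  have "k + l \<in> KR" if k: "k \<in> KR" and l: "l \<in> KR" for k l
  proof -
    have R: "k \<in> R" "l \<in> R" using k l by (auto simp: KR_def)
    have "carry s (k + l) \<in> D" if s: "s \<in> R" for s
    proof -
      have "carry (k + l) s - carry k s \<in> D" by (rule carry_add_mod_D[OF R(1) s l])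
      moreover have "carry k s \<in> D" using k s by (simp add: KR_def carry_commute[of k s])
      ultimately have "carry (k + l) s \<in> D" using subspace_D fs.subspace_add by fastforce
      then show ?thesis by (simp add: carry_commute[of s])
    qed
    then show ?thesis using R subspace_R by (simp add: KR_def fs.subspace_add)
  qed
  moreover have "0 \<in> KR" using subspace_R subspace_D fs.subspace_0 by (auto simp: KR_def)
  ultimately show ?thesis by (simp add: subspace_iff)
qed

lemma S_supp: "S \<subseteq> supp_space b"
  unfolding S_def using D_supp R_supp carry_supp_space subspace_supp_space
  by (intro fs.span_minimal) (auto simp: carries_def)

lemma D_subset_S: "D \<subseteq> S" and carries_subset_S: "carries \<subseteq> S" and subspace_S: "fs.subspace S"
  unfolding S_def using fs.span_superset[of "D \<union> carries"] by auto

text \<open>\<open>kernel_code\<close> is closed under \<open>twist\<close> and keeps the two layers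
  of residue 0; only the residues shrink from \<open>R\<close> to \<open>KR\<close>.\<close>

lemma card_kernel_code: "card kernel_code = card D * card A * card KR"
proof -
  have "card kernel_code = card (low_part kernel_code) * card (first_part kernel_code)
      * card (residue_part kernel_code)"
    using finite_M closed subspace_KR
    by (intro card_twisted) (auto simp: kernel_code_def fs.subspace_add)
  moreover have "low_part kernel_code = D" "first_part kernel_code = A"
    using fs.subspace_0[OF subspace_KR] by (auto simp: kernel_code_def low_part_def first_part_def)
  moreover have "residue_part kernel_code = KR"
    by (auto simp: kernel_code_def residue_part_def KR_def)
  ultimately show ?thesis by simp
qed

lemma span_codeI: "(x, q, r) \<in> M \<Longrightarrow> s \<in> S \<Longrightarrow> (x, q + s, r) \<in> span_code"
  by (auto simp: span_code_def)

lemma M_subset_span_code: "M \<subseteq> span_code"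
  using span_codeI[OF _ fs.subspace_0[OF subspace_S]] by auto

lemma span_code_sub: "span_code \<subseteq> supp_space a \<times> supp_space b \<times> supp_space b"
  using sub S_supp subspace_supp_space[of b] by (fastforce simp: span_code_def fs.subspace_add)

text \<open>\<open>span_code\<close> is closed under \<open>twist\<close> as well; only the low
  layer grows, from \<open>D\<close> to \<open>S\<close>.\<close>

lemma card_span_code: "card span_code = card S * card A * card R"
proof -
  have "twist u v \<in> span_code" if "u \<in> span_code" "v \<in> span_code" for u v
  proof -
    from that obtain x q r s x' q' r' s' where u: "u = (x, q + s, r)" "(x, q, r) \<in> M" "s \<in> S"
      and v: "v = (x', q' + s', r')" "(x', q', r') \<in> M" "s' \<in> S" by (auto simp: span_code_def)
    have "twist u v = (x + x', (q + q' + carry r r') + (s + s'), r + r')"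
      by (simp add: u v algebra_simps)
    moreover have "(x + x', q + q' + carry r r', r + r') \<in> M" using closed[OF u(2) v(2)] by simp
    moreover have "s + s' \<in> S" using u v subspace_S fs.subspace_add by blast
    ultimately show ?thesis unfolding span_code_def by blast
  qed
  then have "card span_code = card (low_part span_code) * card (first_part span_code)
      * card (residue_part span_code)"
    using finite_subset[OF span_code_sub finite_ambient] by (intro card_twisted)
  moreover have "low_part span_code = S"
  proof
    show "low_part span_code \<subseteq> S"
    proof
      fix z assume "z \<in> low_part span_code"
      then obtain q s where "z = q + s" "q \<in> D" "s \<in> S" by (auto simp: low_part_def span_code_def)
      then show "z \<in> S" using D_subset_S subspace_S fs.subspace_add by blast
    qed
    show "S \<subseteq> low_part span_code"
      using span_codeI[of 0 0 0] zero by (auto simp: low_part_def zero_prod_def)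
  qed
  moreover have "first_part span_code = A" "residue_part span_code = R"
    using M_subset_span_code by (auto simp: first_part_def residue_part_def) (auto simp: span_code_def)
  ultimately show ?thesis by simp
qed

text \<open>The plain sum u + v of two codewords differs from the codeword \<open>twist u v\<close>
  exactly by the carry of their residues, so it is a codeword if and only if this carry lies in
  \<open>D\<close>.\<close>

lemma kernel_gray_embed:
  "{w \<in> supp_space (a + 3 * b). (\<lambda>c. c + w) ` gray_embed a b ` M = gray_embed a b ` M}
    = gray_embed a b ` kernel_code" (is "?K = _")
proof (intro equalityI subsetI)
  fix w assume w: "w \<in> ?K"
  \<comment> \<open>Translating the zero codeword shows that w is itself the image of a
    codeword.\<close>
  have "0 \<in> gray_embed a b ` M" using zero gray_embed_zero by force
  then have "0 + w \<in> gray_embed a b ` M" using w by blast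
  then obtain v where v: "v \<in> M" "w = gray_embed a b v" by auto
  obtain x q r where vx: "v = (x, q, r)" by (cases v)
  have "r \<in> R" using v vx by (auto simp: residue_part_def)
  moreover have "carry s r \<in> D" if "s \<in> R" for s
  proof -
    from that obtain x' q' where u: "(x', q', s) \<in> M" by (auto simp: residue_part_def)
    have "gray_embed a b (x', q', s) + w \<in> gray_embed a b ` M" using w u by blast
    then obtain t where t: "t \<in> M" "gray_embed a b ((x', q', s) + v) = gray_embed a b t"
      using v by (auto simp: gray_embed_add)
    have "(x', q', s) + v \<in> supp_space a \<times> supp_space b \<times> supp_space b"
      using subsetD[OF sub u] subsetD[OF sub v(1)] vx by (auto intro: fs.subspace_add)
    then have "(x', q', s) + v = t" using t sub by (intro inj_onD[OF inj_on_gray_embed t(2)]) auto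
    then have "(x' + x, q' + q, s + r) \<in> M" using t vx by simp
    moreover have "(x' + x, q' + q + carry s r, s + r) \<in> M" using closed[OF u v(1)] vx by simp
    ultimately show ?thesis by (rule difference_D)
  qed
  ultimately show "w \<in> gray_embed a b ` kernel_code"
    using v vx by (auto simp: kernel_code_def KR_def)
next
  fix w assume "w \<in> gray_embed a b ` kernel_code"
  then obtain x q r where v: "(x, q, r) \<in> M" "r \<in> KR" and w: "w = gray_embed a b (x, q, r)"
    by (auto simp: kernel_code_def)
  have "gray_embed a b u + w \<in> gray_embed a b ` M" if u: "u \<in> M" for u
  proof -
    obtain x' q' s where ux: "u = (x', q', s)" by (cases u)
    then have "s \<in> R" using u by (auto simp: residue_part_def)
    then have "- carry s r \<in> D" using v(2) subspace_D by (simp add: KR_def fs.subspace_neg)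
    from translate_D[OF closed[OF u v(1), unfolded ux twist_simp] this]
    have "u + (x, q, r) \<in> M" by (simp add: ux)
    then show ?thesis by (simp add: w flip: gray_embed_add)
  qed
  then have "(\<lambda>c. c + w) ` gray_embed a b ` M \<subseteq> gray_embed a b ` M" by auto
  moreover have "inj_on (\<lambda>c. c + w) (gray_embed a b ` M)" by (auto intro: inj_onI)
  ultimately have "(\<lambda>c. c + w) ` gray_embed a b ` M = gray_embed a b ` M"
    using finite_M by (intro endo_inj_surj) auto
  then show "w \<in> ?K" using gray_embed_supp w by simp
qed

text \<open>A carry is the difference of a group sum and a plain sum, so the span contains all of
  \<open>S\<close> in the low layer. Conversely, once \<open>S\<close> is adjoined, carries can be
  subtracted and plain sums stay inside.\<close>

lemma span_gray_embed: "fs.span (gray_embed a b ` M) = gray_embed a b ` span_code"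
proof
  have "fs.subspace (gray_embed a b ` span_code)"
    unfolding subspace_iff
  proof (intro conjI ballI)
    have "0 \<in> span_code" using zero M_subset_span_code by blast
    then show "0 \<in> gray_embed a b ` span_code" using gray_embed_zero by force
    fix y z assume "y \<in> gray_embed a b ` span_code" "z \<in> gray_embed a b ` span_code"
    then obtain x q r s x' q' r' s' where u: "y = gray_embed a b (x, q + s, r)" "(x, q, r) \<in> M" "s \<in> S"
      and v: "z = gray_embed a b (x', q' + s', r')" "(x', q', r') \<in> M" "s' \<in> S"
      by (auto simp: span_code_def)
    have "y + z = gray_embed a b (x + x', (q + q' + carry r r') + (s + s' - carry r r'), r + r')"
      by (simp add: u v algebra_simps flip: gray_embed_add)
    moreover have "(x + x', q + q' + carry r r', r + r') \<in> M" using closed[OF u(2) v(2)] by simp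
    moreover have "r \<in> R" "r' \<in> R" using u v by (auto simp: residue_part_def)
    then have "carry r r' \<in> S" using carries_subset_S by (auto simp: carries_def)
    then have "s + s' - carry r r' \<in> S"
      using u v subspace_S by (simp add: fs.subspace_add fs.subspace_diff)
    ultimately show "y + z \<in> gray_embed a b ` span_code" unfolding span_code_def by blast
  qed
  then show "fs.span (gray_embed a b ` M) \<subseteq> gray_embed a b ` span_code"
    using M_subset_span_code by (intro fs.span_minimal) auto
next
  let ?V = "fs.span (gray_embed a b ` M)"
  have base: "gray_embed a b u \<in> ?V" if "u \<in> M" for u using that by (simp add: fs.span_base)
  have S: "gray_embed a b (0, s, 0) \<in> ?V" if "s \<in> S" for s
  proof -
    have "fs.subspace {s. gray_embed a b (0, s, 0) \<in> ?V}"
      unfolding subspace_iff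
    proof (intro conjI ballI)
      show "0 \<in> {s. gray_embed a b (0, s, 0) \<in> ?V}"
        using gray_embed_zero[of a b] by (simp add: zero_prod_def fs.span_zero)
      fix s t assume "s \<in> {s. gray_embed a b (0, s, 0) \<in> ?V}" "t \<in> {s. gray_embed a b (0, s, 0) \<in> ?V}"
      then show "s + t \<in> {s. gray_embed a b (0, s, 0) \<in> ?V}"
        using gray_embed_add[of a b "(0, s, 0)" "(0, t, 0)"] by (simp add: fs.span_add)
    qed
    moreover have "D \<subseteq> {s. gray_embed a b (0, s, 0) \<in> ?V}"
      using base by (auto simp: low_part_def)
    moreover have "carries \<subseteq> {s. gray_embed a b (0, s, 0) \<in> ?V}"
    proof
      fix s assume "s \<in> carries"
      then obtain x q r x' q' r' where m: "(x, q, r) \<in> M" "(x', q', r') \<in> M" and s: "s = carry r r'"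
        by (auto simp: carries_def residue_part_def)
      have "gray_embed a b (twist (x, q, r) (x', q', r'))
          = gray_embed a b (0, s, 0) + (gray_embed a b (x, q, r) + gray_embed a b (x', q', r'))"
        by (simp add: s algebra_simps flip: gray_embed_add)
      then have "gray_embed a b (0, s, 0) = gray_embed a b (twist (x, q, r) (x', q', r'))
          - (gray_embed a b (x, q, r) + gray_embed a b (x', q', r'))" by (simp only: add_diff_cancel_right')
      then show "s \<in> {s. gray_embed a b (0, s, 0) \<in> ?V}"
        using base[OF m(1)] base[OF m(2)] base[OF closed[OF m]] by (simp add: fs.span_add fs.span_diff)
    qed
    ultimately have "S \<subseteq> {s. gray_embed a b (0, s, 0) \<in> ?V}"
      unfolding S_def by (intro fs.span_minimal) auto
    then show ?thesis using that by auto
  qed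
  show "gray_embed a b ` span_code \<subseteq> ?V"
  proof
    fix y assume "y \<in> gray_embed a b ` span_code"
    then obtain x q r s where "y = gray_embed a b (x, q + s, r)" "(x, q, r) \<in> M" "s \<in> S"
      by (auto simp: span_code_def)
    then show "y \<in> ?V"
      using base[of "(x, q, r)"] S[of s] fs.span_add gray_embed_add[of a b "(x, q, r)" "(0, s, 0)"]
      by fastforce
  qed
qed

lemma card_kernel_gray_embed:
  "card {w \<in> supp_space (a + 3 * b). (\<lambda>c. c + w) ` gray_embed a b ` M = gray_embed a b ` M}
    = card D * card A * card KR"
proof -
  have "inj_on (gray_embed a b) kernel_code"
    using sub by (intro inj_on_subset[OF inj_on_gray_embed]) (auto simp: kernel_code_def)
  then show ?thesis by (simp add: kernel_gray_embed card_image card_kernel_code)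
qed

lemma card_span_gray_embed: "card (fs.span (gray_embed a b ` M)) = card S * card A * card R"
  by (simp add: span_gray_embed card_image card_span_code inj_on_subset[OF inj_on_gray_embed span_code_sub])

end

section \<open>Rank and kernel as cardinalities\<close>

text \<open>Entries are read modulo 3, so applied to a vector over Z_9 this gives the
  residues.\<close>

definition lvec :: "int list \<Rightarrow> nat \<Rightarrow> 3" where
  "lvec xs i = (if i < length xs then of_int (xs ! i) else 0)"

lemma lvec_vadd:
  "3 dvd m \<Longrightarrow> length xs = length ys \<Longrightarrow> lvec (vadd m xs ys) = lvec xs + lvec ys"
  by (rule ext) (simp add: lvec_def vadd_def of_int_F3_mod)

lemma lvec_vsmul: "lvec (vsmul 3 c xs) = (\<lambda>i. of_int c * lvec xs i)"
  by (rule ext) (simp add: lvec_def vsmul_def of_int_F3_mod)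

lemma lvec_vzero [simp]: "lvec (vzero n) = 0"
  by (rule ext) (simp add: lvec_def vzero_def)

lemma length_vsmul: "length (vsmul m c xs) = length xs"
  by (simp add: vsmul_def)

lemma vzero_in_vecs: "0 < m \<Longrightarrow> vzero n \<in> vecs m n"
  by (auto simp: vecs_def vzero_def)

lemma vadd_in_vecs: "0 < m \<Longrightarrow> xs \<in> vecs m n \<Longrightarrow> ys \<in> vecs m n \<Longrightarrow> vadd m xs ys \<in> vecs m n"
  by (auto simp: vecs_def vadd_def)

lemma vsmul_in_vecs: "0 < m \<Longrightarrow> xs \<in> vecs m n \<Longrightarrow> vsmul m c xs \<in> vecs m n"
  by (auto simp: vecs_def vsmul_def)

lemma finite_card_vecs: "finite (vecs (int m) n) \<and> card (vecs (int m) n) = m ^ n"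
proof -
  have "vecs (int m) n = {xs. set xs \<subseteq> {0..int m - 1} \<and> length xs = n}" by (auto simp: vecs_def)
  then show ?thesis
    by (simp add: card_lists_length_eq finite_lists_length_eq)
qed

lemmas finite_card_vecs_numeral = finite_card_vecs[of "numeral k" for k, unfolded of_nat_numeral]

lemma vecs_nth: "xs \<in> vecs m n \<Longrightarrow> i < n \<Longrightarrow> 0 \<le> xs ! i \<and> xs ! i < m"
  by (auto simp: vecs_def dest!: nth_mem)

lemma lvec_supp: "length xs = n \<Longrightarrow> lvec xs \<in> supp_space n"
  by (simp add: supp_space_def lvec_def)

lemma bij_betw_lvec: "bij_betw lvec (vecs 3 n) (supp_space n)"
proof -
  have inj: "inj_on lvec (vecs 3 n)"
  proof (rule inj_onI)
    fix xs ys assume v: "xs \<in> vecs 3 n" "ys \<in> vecs 3 n" and eq: "lvec xs = lvec ys"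
    have len: "length xs = n" "length ys = n" using v by (auto simp: vecs_def)
    show "xs = ys"
    proof (rule nth_equalityI)
      fix i assume "i < length xs"
      then have i: "i < n" using len by simp
      then have "(of_int (xs ! i) :: 3) = of_int (ys ! i)"
        using fun_cong[OF eq, of i] len by (simp add: lvec_def)
      then show "xs ! i = ys ! i"
        using vecs_nth[OF v(1) i] vecs_nth[OF v(2) i] by (simp add: of_int_F3_eq)
    qed (use len in simp)
  qed
  have "lvec ` vecs 3 n = supp_space n"
  proof (rule card_subset_eq)
    show "lvec ` vecs 3 n \<subseteq> supp_space n" by (auto simp: vecs_def intro: lvec_supp)
    show "card (lvec ` vecs 3 n) = card (supp_space n)"
      using finite_card_vecs_numeral[of "num.Bit1 num.One" n] by (simp add: card_image[OF inj] card_supp_space)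
  qed (rule finite_supp_space)
  with inj show ?thesis by (simp add: bij_betw_def)
qed

lemmas inj_on_lvec = bij_betw_imp_inj_on[OF bij_betw_lvec]
lemmas lvec_image = bij_betw_imp_surj_on[OF bij_betw_lvec]

lemma span3_subset_vecs: "B \<subseteq> vecs 3 n \<Longrightarrow> span3 n B \<subseteq> vecs 3 n"
proof
  fix v assume B: "B \<subseteq> vecs 3 n" and "v \<in> span3 n B"
  from this(2) show "v \<in> vecs 3 n"
    by (induction rule: span3.induct)
      (use B in \<open>auto intro!: vzero_in_vecs vadd_in_vecs vsmul_in_vecs\<close>)
qed

text \<open>Both spans arise by repeatedly adding a scaled generator, so each inclusion is an
  induction on that process.\<close>

lemma lvec_span3:
  assumes B: "B \<subseteq> vecs 3 n" shows "lvec ` span3 n B = fs.span (lvec ` B)"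
proof
  have lv: "lvec (vadd 3 (vsmul 3 c s) v) = (\<lambda>i. of_int c * lvec s i) + lvec v"
    if "v \<in> span3 n B" "s \<in> B" for c s v
  proof -
    have "length v = n" "length s = n" using that B span3_subset_vecs[OF B] by (auto simp: vecs_def)
    then show ?thesis by (simp add: lvec_vadd lvec_vsmul length_vsmul)
  qed
  have "lvec v \<in> fs.span (lvec ` B)" if "v \<in> span3 n B" for v
    using that
  proof (induction rule: span3.induct)
    case (step v s c)
    then show ?case
      by (simp only: lv) (rule fs.span_add[OF fs.span_scale[OF fs.span_base]]; simp)
  qed (simp only: lvec_vzero fs.span_zero)
  then show "lvec ` span3 n B \<subseteq> fs.span (lvec ` B)" by auto
  show "fs.span (lvec ` B) \<subseteq> lvec ` span3 n B"
  proof
    fix w assume "w \<in> fs.span (lvec ` B)"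
    then show "w \<in> lvec ` span3 n B"
    proof (induction rule: fs.span_induct_alt)
      case base
      show ?case by (rule image_eqI[of _ _ "vzero n"]) (simp_all only: lvec_vzero span3.zero)
    next
      case (step c x y)
      then obtain s v where s: "s \<in> B" "x = lvec s" and v: "v \<in> span3 n B" "y = lvec v" by auto
      obtain z where z: "c = of_int z" "z \<in> {0..2}"
        by (cases c rule: F3_cases) (auto intro: that[of 0] that[of 1] that[of 2])
      have "(\<lambda>i. c * x i) + y = lvec (vadd 3 (vsmul 3 z s) v)"
        using lv[OF v(1) s(1), of z] s v z by simp
      then show ?case using span3.step[OF v(1) s(1) z(2)] by auto
    qed
  qed
qed

text \<open>The bijection \<open>lvec\<close> carries generating sets of \<open>V\<close> to
  generating sets of its image and back, so the two minima agree.\<close>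

lemma card_eq_dim3:
  assumes V: "V \<subseteq> vecs 3 n" and sub: "fs.subspace (lvec ` V)"
  shows "card V = 3 ^ dim3 n V"
proof -
  have inj: "inj_on lvec V" using inj_on_subset[OF inj_on_lvec V] .
  have fin: "finite V"
    using V finite_card_vecs_numeral[of "num.Bit1 num.One" n] finite_subset by blast
  have "(\<exists>B. finite B \<and> B \<subseteq> V \<and> card B = d \<and> span3 n B = V) \<longleftrightarrow>
        (\<exists>B. finite B \<and> B \<subseteq> lvec ` V \<and> card B = d \<and> fs.span B = lvec ` V)" (is "?L \<longleftrightarrow> ?R") for d
  proof
    assume ?L
    then obtain B where B: "finite B" "B \<subseteq> V" "card B = d" "span3 n B = V" by auto
    then have "card (lvec ` B) = d" "fs.span (lvec ` B) = lvec ` V"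
      using inj_on_subset[OF inj] lvec_span3[of B n] V by (auto simp: card_image)
    then show ?R using B by (intro exI[of _ "lvec ` B"]) auto
  next
    assume ?R
    then obtain B' where B': "finite B'" "B' \<subseteq> lvec ` V" "card B' = d" "fs.span B' = lvec ` V" by auto
    then obtain B where B: "B \<subseteq> V" "B' = lvec ` B" by (auto simp: subset_image_iff)
    have "lvec ` span3 n B = lvec ` V" using lvec_span3[of B n] B B' V by auto
    then have "span3 n B = V"
      using inj_on_image_eq_iff[OF inj_on_lvec, of "span3 n B" n V] span3_subset_vecs[of B n] B V by auto
    moreover have "card B = d" using B B' inj_on_subset[OF inj] by (auto simp: card_image)
    ultimately show ?L using B fin finite_subset by blast
  qed
  then have "dim3 n V = (LEAST d. \<exists>B. finite B \<and> B \<subseteq> lvec ` V \<and> card B = d \<and> fs.span B = lvec ` V)"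
    by (simp add: dim3_def)
  then show ?thesis using LEAST_span_card[OF _ sub] fin by (simp add: card_image[OF inj])
qed

section \<open>From codewords to digit coordinates\<close>

definition coords :: "int list \<times> int list \<Rightarrow> triple3" where
  "coords u = (lvec (fst u), lvec (map (\<lambda>t. t div 3) (snd u)), lvec (snd u))"

text \<open>The integer carry is \<open>(s mod 3 + t mod 3) div 3\<close>; checking the nine pairs
  of digits identifies it with the polynomial \<open>carry\<close>.\<close>

lemma digit_carry:
  "(of_int (((s + t) mod 9) div 3) :: 3)
    = of_int (s div 3) + of_int (t div 3) + carry (of_int s) (of_int t)"
proof -
  have "(((s + t) mod 9) div 3) mod 3 = ((s + t) div 3) mod 3"
    using zmod_zmult2_eq[of 3 "s + t" 3] by simp
  moreover have "(s + t) div 3 = s div 3 + t div 3 + (s mod 3 + t mod 3) div 3" by (rule div_add1_eq)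
  ultimately have "(of_int (((s + t) mod 9) div 3) :: 3)
      = of_int (s div 3) + of_int (t div 3) + of_int ((s mod 3 + t mod 3) div 3)"
    by (metis of_int_F3_eq of_int_add)
  moreover have "s mod 3 \<in> {0, 1, 2}" "t mod 3 \<in> {0, 1, 2}" by auto
  then have "of_int ((s mod 3 + t mod 3) div 3) = (carry (of_int (s mod 3)) (of_int (t mod 3)) :: 3)"
    by (auto simp: carry_def)
  ultimately show ?thesis by (simp add: of_int_F3_mod)
qed

lemma coords_zadd:
  assumes "u \<in> Z3Z9 a b" "v \<in> Z3Z9 a b"
  shows "coords (zadd u v) = twist (coords u) (coords v)"
proof -
  obtain x y x' y' where u: "u = (x, y)" and v: "v = (x', y')" by (cases u; cases v)
  have len: "length x = length x'" "length y = b" "length y' = b"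
    using assms u v by (auto simp: Z3Z9_def vecs_def)
  have "lvec (map (\<lambda>t. t div 3) (vadd 9 y y')) i
      = (lvec (map (\<lambda>t. t div 3) y) + lvec (map (\<lambda>t. t div 3) y') + carry (lvec y) (lvec y')) i" for i
  proof (cases "i < b")
    case True
    then show ?thesis
      using digit_carry[of "y ! i" "y' ! i"] vecs_nth[of y 9 b i] vecs_nth[of y' 9 b i] assms u v len
      by (simp add: lvec_def vadd_def carry_fun_apply Z3Z9_def)
  next
    case False
    then show ?thesis using len by (simp add: lvec_def vadd_def carry_fun_apply)
  qed
  then show ?thesis using len by (auto simp: coords_def zadd_def u v lvec_vadd)
qed

lemma coords_supp: "u \<in> Z3Z9 a b \<Longrightarrow> coords u \<in> supp_space a \<times> supp_space b \<times> supp_space b"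
  by (auto simp: coords_def Z3Z9_def vecs_def intro!: lvec_supp)

lemma inj_on_coords: "inj_on coords (Z3Z9 a b)"
proof (rule inj_onI)
  fix u v assume uv: "u \<in> Z3Z9 a b" "v \<in> Z3Z9 a b" and eq: "coords u = coords v"
  have fst: "fst u = fst v"
    using uv eq by (intro inj_onD[OF inj_on_lvec]) (auto simp: coords_def Z3Z9_def)
  have len: "length (snd u) = b" "length (snd v) = b" using uv by (auto simp: Z3Z9_def vecs_def)
  have "snd u = snd v"
  proof (rule nth_equalityI)
    fix i assume "i < length (snd u)"
    then have i: "i < b" using len by simp
    have "lvec (snd u) i = lvec (snd v) i"
      "lvec (map (\<lambda>t. t div 3) (snd u)) i = lvec (map (\<lambda>t. t div 3) (snd v)) i"
      using eq by (auto simp: coords_def)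
    then have "snd u ! i mod 3 = snd v ! i mod 3" "(snd u ! i div 3) mod 3 = (snd v ! i div 3) mod 3"
      using i len by (simp_all add: lvec_def of_int_F3_eq)
    moreover have "0 \<le> snd u ! i" "snd u ! i < 9" "0 \<le> snd v ! i" "snd v ! i < 9"
      using uv i vecs_nth[of "snd u" 9 b i] vecs_nth[of "snd v" 9 b i] by (auto simp: Z3Z9_def)
    ultimately have "snd u ! i mod 3 = snd v ! i mod 3" "snd u ! i div 3 = snd v ! i div 3" by auto
    then show "snd u ! i = snd v ! i" by (metis mult_div_mod_eq)
  qed (use len in simp)
  with fst show "u = v" by (simp add: prod_eq_iff)
qed

lemma card_Z3Z9: "card (Z3Z9 a b) = 3 ^ (a + 2 * b)"
  using finite_card_vecs_numeral[of "num.Bit1 num.One" a]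
    finite_card_vecs_numeral[of "num.Bit1 (num.Bit0 (num.Bit0 num.One))" b]
  by (simp add: Z3Z9_def card_cartesian_product power_add power_mult)

lemma coords_image: "coords ` Z3Z9 a b = supp_space a \<times> supp_space b \<times> supp_space b"
proof (rule card_subset_eq)
  show "card (coords ` Z3Z9 a b) = card (supp_space a \<times> supp_space b \<times> supp_space b)"
    by (simp add: card_image[OF inj_on_coords] card_Z3Z9 card_cartesian_product card_supp_space
        power_add mult_2)
qed (use coords_supp[of _ a b] finite_supp_space in blast)+

lemma nth_concat_gray:
  "i < 3 * length ys \<Longrightarrow> concat (map gray ys) ! i = gray (ys ! (i div 3)) ! (i mod 3)"
proof (induction ys arbitrary: i)
  case (Cons y ys)
  have len: "length (gray y) = 3" by (simp add: gray_def Let_def)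
  show ?case
  proof (cases "i < 3")
    case True then show ?thesis using len by (simp add: nth_append)
  next
    case False
    then have "i div 3 = Suc ((i - 3) div 3)" "i mod 3 = (i - 3) mod 3" by presburger+
    then show ?thesis using Cons False len by (simp add: nth_append)
  qed
qed simp

lemma length_concat_gray: "length (concat (map gray ys)) = 3 * length ys"
  by (induction ys) (auto simp: gray_def Let_def)

lemma of_int_gray_nth:
  assumes "j < 3" shows "(of_int (gray t ! j) :: 3) = of_int (t div 3) + of_nat j * of_int t"
proof -
  have t: "(of_int (t mod 3) :: 3) = of_int t" by (simp add: of_int_F3_mod)
  from assms have "j = 0 \<or> j = 1 \<or> j = 2" by auto
  then show ?thesis by (auto simp: gray_def Let_def of_int_F3_mod t)
qed

lemma Gray_in_vecs: "u \<in> Z3Z9 a b \<Longrightarrow> Gray u \<in> vecs 3 (a + 3 * b)"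
proof -
  assume u: "u \<in> Z3Z9 a b"
  have "set (gray t) \<subseteq> {0..<3}" for t by (simp add: gray_def Let_def)
  then have "set (concat (map gray ys)) \<subseteq> {0..<3}" for ys by auto
  moreover have "{0..<3::int} = {0..3-1}" by auto
  ultimately show ?thesis using u by (auto simp: Z3Z9_def vecs_def Gray_def length_concat_gray)
qed

lemma lvec_Gray:
  assumes "u \<in> Z3Z9 a b" shows "lvec (Gray u) = gray_embed a b (coords u)"
proof
  fix i
  have len: "length (fst u) = a" "length (snd u) = b" using assms by (auto simp: Z3Z9_def vecs_def)
  consider "i < a" | "a \<le> i" "i < a + 3 * b" | "a + 3 * b \<le> i" by linarith
  then show "lvec (Gray u) i = gray_embed a b (coords u) i"
  proof cases
    case 2
    then have "i - a < 3 * b" "(i - a) div 3 < b" by linarith+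
    then show ?thesis using 2 len
      by (simp add: lvec_def Gray_def gray_embed_def coords_def length_concat_gray nth_append
          nth_concat_gray of_int_gray_nth)
  qed (use len in \<open>auto simp: lvec_def Gray_def gray_embed_def coords_def length_concat_gray nth_append\<close>)
qed

lemma zero_in_Z3Z9: "(vzero a, vzero b) \<in> Z3Z9 a b"
  by (simp add: Z3Z9_def vzero_in_vecs)

lemma zadd_in_Z3Z9: "u \<in> Z3Z9 a b \<Longrightarrow> v \<in> Z3Z9 a b \<Longrightarrow> zadd u v \<in> Z3Z9 a b"
  by (auto simp: Z3Z9_def zadd_def vadd_in_vecs)

lemma coords_zero: "coords (vzero a, vzero b) = 0"
proof -
  have "map (\<lambda>t. t div 3) (vzero b) = vzero b" by (simp add: vzero_def)
  then show ?thesis by (simp add: coords_def zero_prod_def)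
qed

lemma additive_code_twisted: "additive_code a b C \<Longrightarrow> twisted_code a b (coords ` C)"
proof
  assume C: "additive_code a b C"
  then show "coords ` C \<subseteq> supp_space a \<times> supp_space b \<times> supp_space b"
    using coords_supp unfolding additive_code_def by blast
  show "0 \<in> coords ` C" using C coords_zero unfolding additive_code_def by (metis image_eqI)
  fix u v assume "u \<in> coords ` C" "v \<in> coords ` C"
  then obtain x y where xy: "x \<in> C" "u = coords x" "y \<in> C" "v = coords y" by auto
  then have "x \<in> Z3Z9 a b" "y \<in> Z3Z9 a b" "zadd x y \<in> C"
    using C unfolding additive_code_def by blast+
  then have "twist u v = coords (zadd x y)" "zadd x y \<in> C"
    using xy by (simp_all add: coords_zadd)
  then show "twist u v \<in> coords ` C" by auto
qed

text \<open>By \<open>triple_twist\<close> three times a word has coordinates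
  \<open>(0, r, 0)\<close>, which vanish exactly when the residue r does.\<close>

lemma torsion_iff:
  assumes "u \<in> Z3Z9 a b"
  shows "zadd u (zadd u u) = (vzero a, vzero b) \<longleftrightarrow> snd (snd (coords u)) = 0"
proof -
  obtain x q r where c: "coords u = (x, q, r)" by (cases "coords u")
  have "zadd u (zadd u u) = (vzero a, vzero b) \<longleftrightarrow> coords (zadd u (zadd u u)) = coords (vzero a, vzero b)"
    using assms zadd_in_Z3Z9 zero_in_Z3Z9 by (simp add: inj_on_eq_iff[OF inj_on_coords[of a b]])
  also have "coords (zadd u (zadd u u)) = twist (x, q, r) (twist (x, q, r) (x, q, r))"
    using assms zadd_in_Z3Z9 by (simp add: coords_zadd[of _ a b] c)
  also have "\<dots> = twist (twist (x, q, r) (x, q, r)) (x, q, r)"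
    by (simp only: twist_simp carry_commute[of r "r + r"] ac_simps)
  also have "\<dots> = (0, r, 0)" by (rule triple_twist)
  finally show ?thesis by (simp add: c coords_zero zero_prod_def)
qed

lemma torsion_code:
  assumes "C \<subseteq> Z3Z9 a b"
  shows "coords ` {u\<in>C. zadd u (zadd u u) = (vzero a, vzero b)} = {u\<in>coords ` C. snd (snd u) = 0}"
  using torsion_iff assms by blast

text \<open>Links \<open>first_part\<close> with the parameter kappa of the type: it is the
  projection of the subcode of words of order dividing 3.\<close>

lemma card_first_part_eq_dim3:
  assumes "additive_code a b C"
  shows "card (first_part (coords ` C))
    = 3 ^ dim3 a (fst ` {u\<in>C. zadd u (zadd u u) = (vzero a, vzero b)})"
proof -
  interpret tw: twisted_code a b "coords ` C" by (rule additive_code_twisted[OF assms])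
  have sub: "C \<subseteq> Z3Z9 a b" using assms by (simp add: additive_code_def)
  let ?F = "fst ` {u\<in>C. zadd u (zadd u u) = (vzero a, vzero b)}"
  have img: "first_part (coords ` C) = lvec ` ?F"
  proof -
    have "first_part (coords ` C) = fst ` {u\<in>coords ` C. snd (snd u) = 0}"
    proof (intro equalityI subsetI)
      fix x assume "x \<in> first_part (coords ` C)"
      then obtain q where "(x, q, 0) \<in> coords ` C" by (auto simp: first_part_def)
      then show "x \<in> fst ` {u\<in>coords ` C. snd (snd u) = 0}"
        by (intro image_eqI[of _ _ "(x, q, 0)"]) simp_all
    next
      fix x assume "x \<in> fst ` {u\<in>coords ` C. snd (snd u) = 0}"
      then obtain u where u: "u \<in> coords ` C" "snd (snd u) = 0" "x = fst u" by blast
      then have "(x, fst (snd u), 0) \<in> coords ` C" by (cases u) simp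
      then show "x \<in> first_part (coords ` C)" unfolding first_part_def by blast
    qed
    also have "\<dots> = lvec ` ?F"
      unfolding torsion_code[OF sub, symmetric] by (simp add: image_image coords_def)
    finally show ?thesis .
  qed
  have F: "?F \<subseteq> vecs 3 a" using sub by (auto simp: Z3Z9_def)
  have "card ?F = 3 ^ dim3 a ?F" using card_eq_dim3[OF F] img tw.subspace_A by simp
  then show ?thesis
    using inj_on_subset[OF inj_on_lvec F] unfolding img by (simp add: card_image)
qed

section \<open>Layer sizes, kernel and rank of a code of given type\<close>

context
  fixes C a b g d k
  assumes type: "has_type C a b g d k"
begin

lemma code: "additive_code a b C"
  using type by (simp add: has_type_def)

lemma code_sub: "C \<subseteq> Z3Z9 a b"
  using code by (simp add: additive_code_def)

interpretation tw: twisted_code a b "coords ` C"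
  by (rule additive_code_twisted[OF code])

lemma inj_coords_code: "inj_on coords C"
  by (rule inj_on_subset[OF inj_on_coords code_sub])

lemma card_code: "card (coords ` C) = 3 ^ (g + 2 * d)"
proof -
  obtain f where "bij_betw f (Z3Z9 g d) C" using type unfolding has_type_def by blast
  then have "card C = 3 ^ (g + 2 * d)" by (simp add: card_Z3Z9 flip: bij_betw_same_card)
  then show ?thesis by (simp add: card_image inj_coords_code)
qed

text \<open>The isomorphism with \<open>Z3Z9 g d\<close> preserves the words of order dividing 3,
  and there these are the words with residue 0.\<close>

lemma card_code_torsion: "card {u\<in>coords ` C. snd (snd u) = 0} = 3 ^ (g + d)"
proof -
  obtain f where f: "bij_betw f (Z3Z9 g d) C"
    and hom: "\<And>u v. u \<in> Z3Z9 g d \<Longrightarrow> v \<in> Z3Z9 g d \<Longrightarrow> f (zadd u v) = zadd (f u) (f v)"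
    using type unfolding has_type_def by blast
  let ?z = "(vzero g, vzero d)"
  have fC: "f u \<in> Z3Z9 a b" if "u \<in> Z3Z9 g d" for u
    using that f code_sub bij_betwE by blast
  have zz: "zadd ?z ?z = ?z" by (simp add: zadd_def vadd_def vzero_def zip_replicate)
  have "f ?z = zadd (f ?z) (f ?z)" using hom[of ?z ?z] zero_in_Z3Z9 zz by simp
  then have "twist (coords (f ?z)) (coords (f ?z)) = twist (coords (f ?z)) 0"
    using coords_zadd[OF fC fC, OF zero_in_Z3Z9 zero_in_Z3Z9] by (simp add: twist_def)
  then have "coords (f ?z) = coords (vzero a, vzero b)" by (simp add: coords_zero twist_cancel)
  then have fz: "f ?z = (vzero a, vzero b)"
    using inj_onD[OF inj_on_coords] fC zero_in_Z3Z9 by blast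
  have "f (zadd u (zadd u u)) = zadd (f u) (zadd (f u) (f u))" if "u \<in> Z3Z9 g d" for u
    using that by (simp add: hom zadd_in_Z3Z9)
  moreover have "f (zadd u (zadd u u)) = f ?z \<longleftrightarrow> zadd u (zadd u u) = ?z" if "u \<in> Z3Z9 g d" for u
    using that f zadd_in_Z3Z9 zero_in_Z3Z9 by (intro inj_on_eq_iff[of f "Z3Z9 g d"]) (auto simp: bij_betw_def)
  ultimately have "zadd (f u) (zadd (f u) (f u)) = (vzero a, vzero b) \<longleftrightarrow> zadd u (zadd u u) = ?z"
    if "u \<in> Z3Z9 g d" for u using that fz by simp
  then have img: "{u\<in>C. zadd u (zadd u u) = (vzero a, vzero b)} = f ` {u\<in>Z3Z9 g d. zadd u (zadd u u) = ?z}"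
    using f by (auto simp: bij_betw_def)
  have "card {u\<in>coords ` C. snd (snd u) = 0} = card {u\<in>C. zadd u (zadd u u) = (vzero a, vzero b)}"
    unfolding torsion_code[OF code_sub, symmetric] by (intro card_image inj_on_subset[OF inj_coords_code]) auto
  also have "\<dots> = card {u\<in>Z3Z9 g d. zadd u (zadd u u) = ?z}"
    unfolding img using f by (intro card_image) (auto simp: bij_betw_def intro: inj_on_subset)
  also have "\<dots> = card (coords ` {u\<in>Z3Z9 g d. zadd u (zadd u u) = ?z})"
    by (intro card_image[symmetric] inj_on_subset[OF inj_on_coords]) auto
  also have "coords ` {u\<in>Z3Z9 g d. zadd u (zadd u u) = ?z} = {u\<in>coords ` Z3Z9 g d. snd (snd u) = 0}"
    using torsion_iff by blast
  also have "\<dots> = supp_space g \<times> supp_space d \<times> {0 :: nat \<Rightarrow> 3}"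
    using fs.subspace_0[OF subspace_supp_space[of d]] by (auto simp: coords_image simp del: zero_fun_apply)
  also have "card \<dots> = 3 ^ (g + d)" by (simp add: card_cartesian_product card_supp_space power_add)
  finally show ?thesis .
qed

lemma card_first_part: "card (first_part (coords ` C)) = 3 ^ k"
  using type card_first_part_eq_dim3[OF code] by (simp add: has_type_def)

text \<open>So \<open>D\<close> has dimension g + d - k; the product form avoids subtraction of
  naturals.\<close>

lemma card_low_part: "card tw.D * 3 ^ k = 3 ^ (g + d)"
  using card_torsion[OF tw.finite_M tw.closed] card_first_part card_code_torsion by simp

lemma card_residue_part: "card tw.R = 3 ^ d"
proof -
  have "3 ^ (g + 2 * d) = 3 ^ (g + d) * card tw.R"
    using card_twisted[OF tw.finite_M tw.closed] card_code card_first_part card_low_part by simp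
  then have "(3::nat) ^ (g + d) * 3 ^ d = 3 ^ (g + d) * card tw.R"
    by (simp flip: power_add add: mult_2 add.assoc)
  then show ?thesis by simp
qed

lemma lvec_Gray_code: "lvec ` Gray ` C = gray_embed a b ` coords ` C"
  unfolding image_image using code_sub lvec_Gray by (intro image_cong) auto

lemma Gray_code_sub: "Gray ` C \<subseteq> vecs 3 (a + 3 * b)"
  using code_sub Gray_in_vecs by auto

text \<open>The kernel has size \<open>card D * card A * card KR\<close>, and the first two factors
  together give \<open>3 ^ (g + d)\<close>.\<close>

lemma power_ker3: "3 ^ ker3 (a + 3 * b) (Gray ` C) = 3 ^ (g + d) * card tw.KR"
proof -
  let ?n = "a + 3 * b" and ?G = "gray_embed a b ` coords ` C"
  let ?K = "{w \<in> supp_space ?n. (\<lambda>c. c + w) ` ?G = ?G}"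
  have "(\<lambda>c. vadd 3 c x) ` Gray ` C = Gray ` C \<longleftrightarrow> (\<lambda>c. c + lvec x) ` ?G = ?G"
    if x: "x \<in> vecs 3 ?n" for x
  proof -
    have "(\<lambda>c. vadd 3 c x) ` Gray ` C = Gray ` C \<longleftrightarrow>
        lvec ` (\<lambda>c. vadd 3 c x) ` Gray ` C = lvec ` Gray ` C"
      using Gray_code_sub x vadd_in_vecs[of 3 _ ?n x]
      by (intro inj_on_image_eq_iff[OF inj_on_lvec, symmetric]) auto
    also have "lvec ` (\<lambda>c. vadd 3 c x) ` Gray ` C = (\<lambda>c. c + lvec x) ` lvec ` Gray ` C"
      unfolding image_image
      using Gray_code_sub x by (intro image_cong refl lvec_vadd) (auto simp: vecs_def)
    finally show ?thesis by (simp add: lvec_Gray_code)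
  qed
  then have "Kern3 ?n (Gray ` C) = {x\<in>vecs 3 ?n. (\<lambda>c. c + lvec x) ` ?G = ?G}"
    unfolding Kern3_def by blast
  then have img: "lvec ` Kern3 ?n (Gray ` C) = ?K"
    using lvec_image[of ?n] by (auto simp: image_iff)
  have "fs.subspace ?K"
    unfolding subspace_iff
  proof (intro conjI ballI)
    show "0 \<in> ?K" by (simp add: fs.subspace_0)
    fix v w assume "v \<in> ?K" "w \<in> ?K"
    moreover have "(\<lambda>c. c + (v + w)) ` ?G = (\<lambda>c. c + w) ` (\<lambda>c. c + v) ` ?G"
      by (simp add: image_image add.assoc)
    ultimately show "v + w \<in> ?K" by (auto intro: fs.subspace_add)
  qed
  moreover have K: "Kern3 ?n (Gray ` C) \<subseteq> vecs 3 ?n" by (auto simp: Kern3_def)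
  ultimately have "card (Kern3 ?n (Gray ` C)) = 3 ^ ker3 ?n (Gray ` C)"
    unfolding ker3_def using card_eq_dim3 img by simp
  moreover have "card (Kern3 ?n (Gray ` C)) = card ?K"
    using card_image[OF inj_on_subset[OF inj_on_lvec K]] img by simp
  ultimately show ?thesis
    using tw.card_kernel_gray_embed card_first_part card_low_part by simp
qed

text \<open>In the layers of the span, \<open>S\<close> takes the place of \<open>D\<close> in the
  code; the equation expresses this ratio without division.\<close>

lemma power_rank3: "3 ^ rank3 (a + 3 * b) (Gray ` C) * card tw.D = 3 ^ (g + 2 * d) * card tw.S"
proof -
  let ?n = "a + 3 * b"
  have img: "lvec ` span3 ?n (Gray ` C) = fs.span (gray_embed a b ` coords ` C)"
    using lvec_span3[OF Gray_code_sub] lvec_Gray_code by simp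
  have sub: "span3 ?n (Gray ` C) \<subseteq> vecs 3 ?n" by (rule span3_subset_vecs[OF Gray_code_sub])
  have "card (span3 ?n (Gray ` C)) = 3 ^ rank3 ?n (Gray ` C)"
    unfolding rank3_def using card_eq_dim3[OF sub] img by simp
  moreover have "card (span3 ?n (Gray ` C)) = card tw.S * card tw.A * card tw.R"
    using card_image[OF inj_on_subset[OF inj_on_lvec sub]] img tw.card_span_gray_embed by simp
  moreover have "card tw.D * card tw.A * card tw.R = 3 ^ (g + 2 * d)"
    using card_twisted[OF tw.finite_M tw.closed] card_code by simp
  moreover have "card tw.S * card tw.A * card tw.R * card tw.D = card tw.D * card tw.A * card tw.R * card tw.S"
    by simp
  ultimately show ?thesis by presburger
qed

lemma card_low_part_pos: "0 < card tw.D"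
  using fs.subspace_0[OF tw.subspace_D] tw.finite_D by (auto simp: card_gt_0_iff)

text \<open>Since \<open>R\<close> has \<open>3 ^ d\<close> elements, the kernel defect is the
  codimension of \<open>KR\<close> in \<open>R\<close>.\<close>

lemma ker3_iff:
  "int (ker3 (a + 3 * b) (Gray ` C)) = int g + 2 * int d - int kb \<longleftrightarrow> card tw.R = 3 ^ kb * card tw.KR"
    (is "?L \<longleftrightarrow> ?R")
proof -
  let ?k = "ker3 (a + 3 * b) (Gray ` C)"
  have "?L \<longleftrightarrow> ?k + kb = g + d + d" by linarith
  also have "\<dots> \<longleftrightarrow> (3::nat) ^ (?k + kb) = 3 ^ (g + d + d)" by (subst power_inject_exp) auto
  also have "\<dots> \<longleftrightarrow> 3 ^ (g + d) * (3 ^ kb * card tw.KR) = 3 ^ (g + d) * card tw.R"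
    unfolding power_add[of _ ?k] power_ker3 power_add[of _ "g + d"] card_residue_part
    by (simp only: mult.assoc mult.commute[of "3 ^ kb"])
  finally show ?thesis by auto
qed

text \<open>The rank excess is the dimension of \<open>S\<close> modulo \<open>D\<close>.\<close>

lemma rank3_iff:
  "int (rank3 (a + 3 * b) (Gray ` C)) = int g + 2 * int d + int rb \<longleftrightarrow> card tw.S = 3 ^ rb * card tw.D"
    (is "?L \<longleftrightarrow> ?R")
proof -
  let ?k = "rank3 (a + 3 * b) (Gray ` C)"
  have "?L \<longleftrightarrow> ?k = g + 2 * d + rb" by linarith
  also have "\<dots> \<longleftrightarrow> (3::nat) ^ ?k = 3 ^ (g + 2 * d + rb)" by (subst power_inject_exp) auto
  also have "\<dots> \<longleftrightarrow> 3 ^ ?k * card tw.D = 3 ^ (g + 2 * d + rb) * card tw.D" using card_low_part_pos by simp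
  also have "\<dots> \<longleftrightarrow> 3 ^ (g + 2 * d) * card tw.S = 3 ^ (g + 2 * d) * (3 ^ rb * card tw.D)"
    by (simp only: power_rank3 power_add[of _ "g + 2 * d"] mult.assoc)
  finally show ?thesis by auto
qed

end

section \<open>The upper bound for the rank\<close>

definition defect_bound :: "nat \<Rightarrow> nat" where
  "defect_bound k = (k choose 2) + ((k + 2) choose 3)"

text \<open>The four summands count, for k elements, the squares, the products of two distinct
  elements, the products v v w over ordered pairs, and the products of three distinct elements. Both
  the upper bound and the construction are organised by these families.\<close>

lemma defect_bound_eq: "defect_bound k = k + (k choose 2) + k * (k - 1) + (k choose 3)"
proof -
  have "(k + 2) choose 3 = (k choose 3) + 2 * (k choose 2) + k"
    by (simp add: eval_nat_numeral)
  moreover have "2 * (k choose 2) = k * (k - 1)" 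
    unfolding choose_two by (intro dvd_mult_div_cancel) auto
  ultimately show ?thesis by (simp add: defect_bound_def)
qed

lemma card_ordered_pairs:
  assumes "finite W"
  shows "card {(v, w). v \<in> W \<and> w \<in> W \<and> v \<noteq> w} = card W * (card W - 1)"
proof -
  have "{(v, w). v \<in> W \<and> w \<in> W \<and> v \<noteq> w} = (SIGMA v:W. W - {v})" by auto
  then show ?thesis using assms by simp
qed

lemma subspace_times_preimage:
  assumes "fs.subspace Y" shows "fs.subspace {w :: nat \<Rightarrow> 3. w * v \<in> Y}"
  using assms by (auto simp: subspace_iff distrib_right)

context twisted_code
begin

text \<open>Both sides say that all carries lie in \<open>D\<close>. This is why the kernel defect
  and the rank excess vanish together.\<close>

lemma S_eq_D_iff: "S = D \<longleftrightarrow> KR = R"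
proof
  assume "S = D" then show "KR = R" using carries_subset_S by (auto simp: KR_def carries_def)
next
  assume "KR = R"
  then have "carries \<subseteq> D" by (auto simp: KR_def carries_def)
  then show "S = D" using subspace_D by (simp add: S_def Un_absorb2)
qed

text \<open>Modulo \<open>D\<close> the carry only depends on its arguments modulo \<open>KR\<close>, so \<open>S\<close> is spanned over \<open>D\<close> by
  the products of two or three elements of a basis of \<open>R\<close> modulo \<open>KR\<close>; the cubes
  \<open>w * w * w = w\<close> already lie in \<open>D\<close>.\<close>

lemma card_S_le:
  assumes "card R = 3 ^ kb * card KR"
  shows "card S \<le> card D * 3 ^ defect_bound kb"
proof -
  have KR: "KR \<subseteq> R" by (auto simp: KR_def)
  obtain W where W: "finite W" "W \<subseteq> R" "fs.span (KR \<union> W) = R" "card R = card KR * 3 ^ card W"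
    using subspace_extend[OF finite_R subspace_R KR subspace_KR] by auto
  have "0 \<in> KR" using subspace_KR fs.subspace_0 by blast
  then have "card KR > 0" using finite_subset[OF KR finite_R] by (auto simp: card_gt_0_iff)
  then have cW: "card W = kb" using W(4) assms by simp
  let ?X1 = "(\<lambda>w. w * w) ` W"
  let ?X2 = "(\<lambda>P. \<Prod>P) ` {P. P \<subseteq> W \<and> card P = 2}"
  let ?X3 = "(\<lambda>(v, w). v * v * w) ` {(v, w). v \<in> W \<and> w \<in> W \<and> v \<noteq> w}"
  let ?X4 = "(\<lambda>P. \<Prod>P) ` {P. P \<subseteq> W \<and> card P = 3}"
  let ?X = "?X1 \<union> ?X2 \<union> ?X3 \<union> ?X4"
  have finP: "finite {P. P \<subseteq> W \<and> card P = j}" for j using W(1) by simp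
  have finpair: "finite {(v, w). v \<in> W \<and> w \<in> W \<and> v \<noteq> w}"
    by (rule finite_subset[of _ "W \<times> W"]) (use W(1) in auto)
  have finX: "finite ?X" using W(1) finP finpair by simp
  have "card ?X \<le> card ?X1 + card ?X2 + card ?X3 + card ?X4"
    by (intro order_trans[OF card_Un_le] add_mono order_refl)
  also have "\<dots> \<le> kb + (kb choose 2) + kb * (kb - 1) + (kb choose 3)"
    using card_image_le[OF W(1), of "\<lambda>w. w * w"] card_image_le[OF finP, of "\<lambda>P. \<Prod>P" 2]
      card_image_le[OF finP, of "\<lambda>P. \<Prod>P" 3] card_image_le[OF finpair, of "\<lambda>(v, w). v * v * w"]
    by (intro add_mono) (simp_all add: n_subsets[OF W(1)] cW card_ordered_pairs[OF W(1)])
  finally have cX: "card ?X \<le> defect_bound kb" by (simp add: defect_bound_eq)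
  let ?Y = "fs.span (D \<union> ?X)"
  have Y: "D \<subseteq> ?Y" "?X \<subseteq> ?Y" using fs.span_superset[of "D \<union> ?X"] by auto
  have W2: "v * w \<in> ?Y" if "v \<in> W" "w \<in> W" for v w
  proof (cases "v = w")
    case True then show ?thesis using that Y by auto
  next
    case False
    then have "v * w = \<Prod>{v, w}" "card {v, w} = 2" "{v, w} \<subseteq> W" using that by auto
    then have "v * w \<in> ?X2" by blast
    then show ?thesis using Y by blast
  qed
  have W3: "u * v * w \<in> ?Y" if uvw: "u \<in> W" "v \<in> W" "w \<in> W" for u v w
  proof -
    have X3: "x * x * y \<in> ?Y" if "x \<in> W" "y \<in> W" for x y
    proof (cases "x = y")
      case True
      then have "x * x * y = x" by (simp only: fun3_cube)
      then show ?thesis using that W(2) R_subset_D Y by auto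
    next
      case False
      then have "x * x * y \<in> ?X3" using that by (intro image_eqI[of _ _ "(x, y)"]) auto
      then show ?thesis using Y by blast
    qed
    consider "u = v" | "u = w" | "v = w" | "u \<noteq> v" "u \<noteq> w" "v \<noteq> w" by blast
    then show ?thesis
    proof cases
      case 1 then show ?thesis using X3 uvw by simp
    next
      case 2 then show ?thesis using X3[of u v] uvw by (simp add: ac_simps)
    next
      case 3 then show ?thesis using X3[of v u] uvw by (simp add: ac_simps)
    next
      case 4
      then have "u * v * w = \<Prod>{u, v, w}" "card {u, v, w} = 3" "{u, v, w} \<subseteq> W"
        using uvw by (auto simp: ac_simps)
      then have "u * v * w \<in> ?X4" by blast
      then show ?thesis using Y by blast
    qed
  qed
  \<comment> \<open>The product with a fixed w is linear, so membership extends from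
    \<open>W\<close> to its span; applied in each factor in turn, this gives \<open>S2\<close> and
    \<open>S3\<close>.\<close>
  have lift: "\<forall>v\<in>fs.span W. v * w \<in> ?Y" if "\<And>v. v \<in> W \<Longrightarrow> v * w \<in> ?Y" for w
    using fs.span_minimal[of W "{v. v * w \<in> ?Y}"] subspace_times_preimage[of ?Y w] that by auto
  have S2: "v * w \<in> ?Y" if "v \<in> fs.span W" "w \<in> fs.span W" for v w
  proof -
    have "v * w \<in> ?Y" if "v \<in> fs.span W" "w \<in> W" for v w using lift[of w] W2 that by blast
    then show ?thesis using lift[of v] that by (simp add: mult.commute[of _ v])
  qed
  have S3: "u * v * w \<in> ?Y" if "u \<in> fs.span W" "v \<in> fs.span W" "w \<in> fs.span W" for u v w
  proof -
    have 1: "u * v * w \<in> ?Y" if "u \<in> fs.span W" "v \<in> W" "w \<in> W" for u v w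
      using lift[of "v * w"] W3 that by (simp add: mult.assoc)
    have e: "v * (u * w) = u * v * w" for u v w :: "nat \<Rightarrow> 3" by (simp only: ac_simps)
    have 2: "u * v * w \<in> ?Y" if "u \<in> fs.span W" "v \<in> fs.span W" "w \<in> W" for u v w
      using lift[of "u * w", unfolded e] 1 that by blast
    then show ?thesis using lift[of "u * v"] that by (simp add: mult.commute[of _ "u * v"])
  qed
  have cW: "carry v w \<in> ?Y" if "v \<in> fs.span W" "w \<in> fs.span W" for v w
    unfolding carry_def using S2[of v w] S3[of v v w] S3[of v w w] that
    by (intro fs.span_neg fs.span_add) auto
  have "carries \<subseteq> ?Y"
  proof
    fix z assume "z \<in> carries"
    then obtain r s where rs: "r \<in> R" "s \<in> R" "z = carry r s" by (auto simp: carries_def)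
    have "\<exists>k w. r = w + k \<and> k \<in> KR \<and> w \<in> fs.span W" if "r \<in> R" for r
    proof -
      have "r \<in> fs.span (KR \<union> W)" using that W by simp
      then obtain k w where "r = k + w" "k \<in> KR" "w \<in> fs.span W"
        using fs.span_eq_iff[THEN iffD2, OF subspace_KR] unfolding fs.span_Un by blast
      then show ?thesis by (metis add.commute)
    qed
    then obtain k w k' w' where r: "r = w + k" "k \<in> KR" "w \<in> fs.span W"
      and s: "s = w' + k'" "k' \<in> KR" "w' \<in> fs.span W" using rs by metis
    have spW: "fs.span W \<subseteq> R" using W(2) subspace_R by (intro fs.span_minimal) auto
    have "carry r s - carry w s \<in> D" using carry_add_mod_D[of w s k] r spW rs by auto
    \<comment> \<open>Having replaced r by w, the second argument s is replaced by w' in the same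
      way, using symmetry of the carry.\<close>
    moreover have "carry s w - carry w' w \<in> D" using carry_add_mod_D[of w' w k'] r s spW by auto
    ultimately have "(carry r s - carry w s) + (carry s w - carry w' w) \<in> D"
      using subspace_D fs.subspace_add by blast
    then have "carry r s - carry w w' \<in> ?Y"
      using Y by (auto simp: carry_commute[of s w] carry_commute[of w' w])
    then have "(carry r s - carry w w') + carry w w' \<in> ?Y" using cW r s by (intro fs.span_add) auto
    then show "z \<in> ?Y" by (simp add: rs)
  qed
  then have "S \<subseteq> ?Y" unfolding S_def using Y by (intro fs.span_minimal) auto
  moreover note spD = fs.span_eq_iff[THEN iffD2, OF subspace_D]
  have fY: "finite ?Y" "card ?Y \<le> card D * 3 ^ card ?X"
    using card_span_Un_le[OF finX, of D, unfolded spD, OF finite_D] by blast+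
  ultimately have "card S \<le> card D * 3 ^ card ?X" using card_mono[OF fY(1)] order_trans by blast
  also have "\<dots> \<le> card D * 3 ^ defect_bound kb" using cX by (simp add: power_increasing)
  finally show ?thesis .
qed

end

section \<open>Independent columns\<close>

text \<open>Evaluations at the points of J are linearly independent functionals on T, expressed by
  arbitrary prescribed values.\<close>

definition interpolates :: "('x \<Rightarrow> 3) set \<Rightarrow> 'x set \<Rightarrow> bool" where
  "interpolates T J \<longleftrightarrow> (\<forall>\<phi>. \<exists>t\<in>T. \<forall>h\<in>J. t h = \<phi> h)"

lemma interpolates_empty: "fs.subspace T \<Longrightarrow> interpolates T {}"
  using fs.subspace_0 by (auto simp: interpolates_def)

lemma interpolates_insert:
  assumes T: "fs.subspace T" and J: "interpolates T J"
    and t: "t \<in> T" "\<And>h'. h' \<in> J \<Longrightarrow> t h' = 0" "t h \<noteq> 0"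
  shows "interpolates T (insert h J)"
  unfolding interpolates_def
proof
  fix \<phi>
  obtain s where s: "s \<in> T" "\<And>h. h \<in> J \<Longrightarrow> s h = \<phi> h" using J unfolding interpolates_def by blast
  \<comment> \<open>As \<open>t h * t h = 1\<close>, adding this multiple of t corrects the value at
    h and changes nothing on J.\<close>
  let ?c = "(\<phi> h - s h) * t h"
  have "s + (\<lambda>x. ?c * t x) \<in> T" by (rule fs.subspace_add[OF T s(1) fs.subspace_scale[OF T t(1)]])
  moreover have "(s + (\<lambda>x. ?c * t x)) h = \<phi> h"
    by (simp only: plus_fun_apply mult.assoc F3_unit[OF t(3)] mult_1_right) simp
  moreover have "(s + (\<lambda>x. ?c * t x)) h' = \<phi> h'" if "h' \<in> J" for h' using that s t by simp
  ultimately show "\<exists>t\<in>T. \<forall>h\<in>insert h J. t h = \<phi> h" by blast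
qed

text \<open>The functions \<open>t i\<close> are dual to the points \<open>p i\<close> up to nonzero
  scalars and vanish on J, so the points can be added one by one; they are distinct and new.\<close>

lemma interpolates_Un:
  assumes T: "fs.subspace T" and fJ: "finite J" and J: "interpolates T J" and I: "finite I"
    and t: "\<And>i. i \<in> I \<Longrightarrow> t i \<in> T" "\<And>i h. i \<in> I \<Longrightarrow> h \<in> J \<Longrightarrow> t i h = 0"
      "\<And>i. i \<in> I \<Longrightarrow> t i (p i) \<noteq> 0" "\<And>i j. i \<in> I \<Longrightarrow> j \<in> I \<Longrightarrow> i \<noteq> j \<Longrightarrow> t i (p j) = 0"
  shows "interpolates T (J \<union> p ` I) \<and> card (J \<union> p ` I) = card J + card I"
  using I t
proof (induction I rule: finite_induct)
  case empty then show ?case using J by simp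
next
  case (insert i I)
  then have IH: "interpolates T (J \<union> p ` I)" "card (J \<union> p ` I) = card J + card I" by auto
  have van: "t i h = 0" if "h \<in> J \<union> p ` I" for h
    using that insert.prems(2)[of i h] insert.prems(4)[of i] insert.hyps by auto
  have "interpolates T (insert (p i) (J \<union> p ` I))"
    using insert.prems van by (intro interpolates_insert[OF T IH(1), of "t i"]) auto
  moreover have "p i \<notin> J \<union> p ` I" using van insert.prems(3)[of i] by auto
  then have "card (insert (p i) (J \<union> p ` I)) = card J + card (insert i I)"
    using IH(2) insert.hyps fJ by simp
  ultimately show ?case by simp
qed

text \<open>Steinitz exchange by the pigeonhole principle: J admits fewer value patterns than E, so
  two functions agree on J but differ at some h in E. Their difference vanishes on J and not at
  h.\<close>

lemma interpolates_exchange: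
  assumes T: "fs.subspace T" and fin: "finite J" "finite E"
    and J: "interpolates T J" and E: "interpolates T E" and less: "card J < card E"
  shows "\<exists>h\<in>E - J. interpolates T (insert h J)"
proof -
  obtain \<tau> where \<tau>: "\<And>\<phi>. \<tau> \<phi> \<in> T" "\<And>\<phi> h. h \<in> E \<Longrightarrow> \<tau> \<phi> h = \<phi> h"
    using E unfolding interpolates_def by metis
  let ?X = "E \<rightarrow>\<^sub>E (UNIV :: 3 set)" and ?Y = "J \<rightarrow>\<^sub>E (UNIV :: 3 set)"
  have "card ?Y < card ?X" using less fin by (simp add: card_PiE)
  moreover have "finite ?Y" using fin by (intro finite_PiE) auto
  moreover have "(\<lambda>\<phi>. restrict (\<tau> \<phi>) J) ` ?X \<subseteq> ?Y" by auto
  ultimately have "\<not> inj_on (\<lambda>\<phi>. restrict (\<tau> \<phi>) J) ?X"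
    using card_inj_on_le[of _ ?X ?Y] by fastforce
  then obtain \<phi> \<psi> where ne: "\<phi> \<in> ?X" "\<psi> \<in> ?X" "\<phi> \<noteq> \<psi>"
    and eq: "restrict (\<tau> \<phi>) J = restrict (\<tau> \<psi>) J" by (auto simp: inj_on_def)
  obtain h where h: "h \<in> E" "\<phi> h \<noteq> \<psi> h" using ne by (metis PiE_ext)
  let ?t = "\<tau> \<phi> - \<tau> \<psi>"
  have "?t \<in> T" using \<tau> T by (intro fs.subspace_diff)
  moreover have van: "?t h' = 0" if "h' \<in> J" for h'
    using fun_cong[OF eq, of h'] that by simp
  moreover have th: "?t h \<noteq> 0" using h \<tau> by simp
  ultimately have "interpolates T (insert h J)" using interpolates_insert[OF T J] by blast
  moreover have "h \<notin> J" using van th by blast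
  ultimately show ?thesis using h by blast
qed

section \<open>Functions of a column that arise from carries\<close>

definition dot :: "nat \<Rightarrow> (nat \<Rightarrow> 3) \<Rightarrow> (nat \<Rightarrow> 3) \<Rightarrow> 3" where
  "dot n h a = (\<Sum>i<n. h i * a i)"

text \<open>A column \<open>h\<close> appended to an identity matrix contributes this function of a pair of rows
  to the carries modulo the code.\<close>

definition defect :: "nat \<Rightarrow> (nat \<Rightarrow> 3) \<Rightarrow> (nat \<Rightarrow> 3) \<Rightarrow> (nat \<Rightarrow> 3) \<Rightarrow> 3" where
  "defect n a b h = carry (dot n h a) (dot n h b) - dot n h (carry a b)"

text \<open>The rows are parameters and the column is the variable, so the points of interpolation
  are columns.\<close>

definition defect_space :: "nat \<Rightarrow> ((nat \<Rightarrow> 3) \<Rightarrow> 3) set" where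
  "defect_space n = fs.span {defect n a b | a b. a \<in> supp_space n \<and> b \<in> supp_space n}"

definition unit :: "3 \<Rightarrow> nat \<Rightarrow> nat \<Rightarrow> 3" where
  "unit c i j = (if j = i then c else 0)"

definition indic :: "nat set \<Rightarrow> nat \<Rightarrow> 3" where
  "indic A i = (if i \<in> A then 1 else 0)"

lemma unit_supp: "i < n \<Longrightarrow> unit c i \<in> supp_space n"
  by (auto simp: supp_space_def unit_def)

lemma dot_unit: "i < n \<Longrightarrow> dot n h (unit c i) = h i * c"
  by (simp add: dot_def unit_def if_distrib sum.delta cong: if_cong)

lemma dot_add: "dot n h (a + b) = dot n h a + dot n h b"
  by (simp add: dot_def distrib_left sum.distrib)

lemma dot_zero: "dot n h 0 = 0" "dot n 0 a = 0"
  by (simp_all add: dot_def)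

lemma carry_unit: "carry a (unit c i) = unit (carry (a i) c) i"
  by (rule ext) (auto simp: carry_fun_apply unit_def)

lemma defect_in_space: "a \<in> supp_space n \<Longrightarrow> b \<in> supp_space n \<Longrightarrow> defect n a b \<in> defect_space n"
  unfolding defect_space_def by (intro fs.span_base) auto

lemma subspace_defect_space: "fs.subspace (defect_space n)"
  by (simp add: defect_space_def)

lemma defect_unit:
  assumes "i < n" shows "defect n a (unit c i) h = carry (dot n h a) (h i * c) - h i * carry (a i) c"
  using assms by (simp add: defect_def carry_unit dot_unit)

text \<open>With both rows equal to the i-th unit vector the defect is h_i - h_i^2, because h_i^3 =
  h_i and the carry of 1 and 1 is 0.\<close>

lemma square_in_space:
  assumes "i < n" shows "(\<lambda>h. h i * h i - h i) \<in> defect_space n"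
proof -
  have "(\<lambda>h. h i * h i - h i) = - defect n (unit 1 i) (unit 1 i)"
  proof
    fix h show "h i * h i - h i = (- defect n (unit 1 i) (unit 1 i)) h"
      using assms by (cases "h i" rule: F3_cases) (simp_all add: defect_unit dot_unit carry_def unit_def)
  qed
  then show ?thesis
    using assms subspace_defect_space by (simp only:) (intro fs.subspace_neg defect_in_space unit_supp)
qed

text \<open>The two rows have disjoint supports, so their own carry vanishes and only the carry of
  the column entries remains.\<close>

lemma carry_in_space:
  assumes "i < n" "j < n" "i \<noteq> j" shows "(\<lambda>h. carry (h i * c) (h j)) \<in> defect_space n"
proof -
  have "(\<lambda>h. carry (h i * c) (h j)) = defect n (unit c i) (unit 1 j)"
    using assms by (simp add: fun_eq_iff defect_unit dot_unit unit_def)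
  then show ?thesis using assms by (simp add: defect_in_space unit_supp)
qed

text \<open>Summing over c = 1 and c = 2 cancels the terms of odd degree in h_i and leaves -5 h_i^2
  h_j = h_i^2 h_j.\<close>

lemma square_times_in_space:
  assumes "i < n" "j < n" "i \<noteq> j" shows "(\<lambda>h. h i * h i * h j) \<in> defect_space n"
proof -
  have "(\<lambda>h::nat \<Rightarrow> 3. h i * h i * h j) = (\<lambda>h. carry (h i * 1) (h j)) + (\<lambda>h. carry (h i * 2) (h j))"
  proof
    fix h :: "nat \<Rightarrow> 3" show "h i * h i * h j = ((\<lambda>h. carry (h i * 1) (h j)) + (\<lambda>h. carry (h i * 2) (h j))) h"
      by (cases "h i" rule: F3_cases; cases "h j" rule: F3_cases) (simp_all add: carry_def)
  qed
  then show ?thesis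
    using fs.subspace_add[OF subspace_defect_space carry_in_space[OF assms, of 1] carry_in_space[OF assms, of 2]]
    by (simp only:)
qed

lemma product_in_space:
  assumes "i < n" "j < n" "i \<noteq> j" shows "(\<lambda>h. h i * h j) \<in> defect_space n"
proof -
  have "(\<lambda>h::nat \<Rightarrow> 3. h i * h j) = - ((\<lambda>h. carry (h i * 1) (h j)) + (\<lambda>h. h i * h i * h j) + (\<lambda>h. h j * h j * h i))"
    by (simp add: fun_eq_iff carry_def algebra_simps)
  moreover have "- ((\<lambda>h. carry (h i * 1) (h j)) + (\<lambda>h. h i * h i * h j) + (\<lambda>h. h j * h j * h i)) \<in> defect_space n"
    using assms by (intro fs.subspace_neg fs.subspace_add subspace_defect_space carry_in_space square_times_in_space) auto
  ultimately show ?thesis by (simp only:)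
qed

text \<open>Polarising the term r^2 s of the carry in r gives -2 h_i h_j h_l = h_i h_j h_l.\<close>

lemma triple_product_in_space:
  assumes "i < n" "j < n" "l < n" "i \<noteq> j" "i \<noteq> l" "j \<noteq> l"
  shows "(\<lambda>h. h i * h j * h l) \<in> defect_space n"
proof -
  have "(\<lambda>h. h i * h j * h l) = defect n (unit 1 i + unit 1 j) (unit 1 l)
      - (\<lambda>h. carry (h i * 1) (h l)) - (\<lambda>h. carry (h j * 1) (h l))"
  proof
    fix h
    have "defect n (unit 1 i + unit 1 j) (unit 1 l) h = carry (h i + h j) (h l)"
      using assms by (simp add: defect_unit dot_unit dot_add) (simp add: unit_def)
    then show "h i * h j * h l = (defect n (unit 1 i + unit 1 j) (unit 1 l)
      - (\<lambda>h. carry (h i * 1) (h l)) - (\<lambda>h. carry (h j * 1) (h l))) h"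
      by (cases "h i" rule: F3_cases; cases "h j" rule: F3_cases; cases "h l" rule: F3_cases)
        (simp_all add: carry_def)
  qed
  moreover have "defect n (unit 1 i + unit 1 j) (unit 1 l)
      - (\<lambda>h. carry (h i * 1) (h l)) - (\<lambda>h. carry (h j * 1) (h l)) \<in> defect_space n"
    using assms by (intro fs.subspace_diff subspace_defect_space carry_in_space defect_in_space
        fs.subspace_add subspace_supp_space unit_supp)
  ultimately show ?thesis by (simp only:)
qed

lemma prod2_in_space:
  assumes "A \<subseteq> {..<n}" "card A = 2" shows "(\<lambda>h. \<Prod>i\<in>A. h i) \<in> defect_space n"
proof -
  obtain i j where "A = {i, j}" "i \<noteq> j" using assms(2) by (auto simp: card_2_iff)
  then show ?thesis using product_in_space[of i n j] assms(1) by simp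
qed

lemma prod3_in_space:
  assumes "A \<subseteq> {..<n}" "card A = 3" shows "(\<lambda>h. \<Prod>i\<in>A. h i) \<in> defect_space n"
proof -
  obtain i j l where "A = {i, j, l}" "i \<noteq> j" "j \<noteq> l" "i \<noteq> l" using assms(2) by (auto simp: card_3_iff)
  then show ?thesis using triple_product_in_space[of i n j l] assms(1) by (simp add: mult.assoc)
qed

lemma prod_indic_neq:
  assumes "finite A" "finite B" "card B \<le> card A" "A \<noteq> B" shows "(\<Prod>i\<in>A. indic B i) = 0"
proof -
  have "\<not> A \<subseteq> B" using assms card_seteq by blast
  then show ?thesis using assms(1) by (intro prod_zero) (auto simp: indic_def)
qed

text \<open>Four families of columns, one for each summand of \<open>defect_bound_eq\<close>, are
  added in turn. Each comes with dual functions from \<open>defect_space n\<close> that vanish on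
  the earlier columns.\<close>

lemma exists_interpolated_set:
  assumes "k \<le> n"
  shows "\<exists>E. finite E \<and> E \<subseteq> supp_space k \<and> card E = defect_bound k \<and> interpolates (defect_space n) E"
proof -
  let ?T = "defect_space n"
  note T = subspace_defect_space[of n]
  let ?I = "{..<k}" and ?P = "\<lambda>j. {A. A \<subseteq> {..<k} \<and> card A = j}"
    and ?O = "{(i, j). i \<in> {..<k} \<and> j \<in> {..<k} \<and> i \<noteq> j}"
  \<comment> \<open>The entry 2 is essential: h_i^2 - h_i vanishes at 0 and 1 but not at 2.\<close>
  let ?E1 = "{} \<union> unit 2 ` ?I"
  have 1: "interpolates ?T ?E1 \<and> card ?E1 = card ({} :: (nat \<Rightarrow> 3) set) + card ?I"
    using assms by (intro interpolates_Un[where t = "\<lambda>i h. h i * h i - h i"] T interpolates_empty)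
      (auto simp: square_in_space unit_def)
  let ?E2 = "?E1 \<union> indic ` ?P 2"
  have finP: "finite (?P j)" for j by simp
  have finA: "finite A" if "A \<in> ?P j" for A j using that finite_subset by auto
  have out: "\<exists>i\<in>A. i \<notin> B" if "A \<in> ?P j" "finite B" "card B < j" for A B j
    using that card_mono[of B A] by auto
  have v1: "(\<Prod>i\<in>A. unit 2 l i) = 0" if A: "A \<in> ?P j" "2 \<le> j" for A j l
    using out[OF A(1), of "{l}"] A finA[OF A(1)] by (intro prod_zero) (auto simp: unit_def)
  have 2: "interpolates ?T ?E2 \<and> card ?E2 = card ?E1 + card (?P 2)"
  proof (intro interpolates_Un[where t = "\<lambda>A h. \<Prod>i\<in>A. h i"] T)
    show "(\<lambda>h. \<Prod>i\<in>A. h i) \<in> ?T" if "A \<in> ?P 2" for A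
      using that assms by (intro prod2_in_space) auto
    show "(\<Prod>i\<in>A. h i) = 0" if "A \<in> ?P 2" "h \<in> ?E1" for A h using that v1[OF that(1)] by auto
    show "(\<Prod>i\<in>A. indic A i) \<noteq> 0" if "A \<in> ?P 2" for A by (simp add: indic_def)
    show "(\<Prod>i\<in>A. indic B i) = 0" if "A \<in> ?P 2" "B \<in> ?P 2" "A \<noteq> B" for A B
      using that finA[OF that(1)] finA[OF that(2)] by (intro prod_indic_neq) auto
  qed (use 1 finP in auto)
  \<comment> \<open>The dual function h_i h_j (1 - h_i) is nonzero only if h_i = 2 and h_j is
    nonzero. It therefore vanishes on indicator columns and on the pair taken in the opposite
    order.\<close>
  let ?p = "\<lambda>(i, j). unit 2 i + unit 1 j"
  let ?E3 = "?E2 \<union> ?p ` ?O"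
  have finO: "finite ?O" by (rule finite_subset[of _ "{..<k} \<times> {..<k}"]) auto
  have 3: "interpolates ?T ?E3 \<and> card ?E3 = card ?E2 + card ?O"
  proof (intro interpolates_Un[where t = "\<lambda>(i, j) h. h i * h j - h i * h i * h j"] T)
    show "(case x of (i, j) \<Rightarrow> \<lambda>h. h i * h j - h i * h i * h j) \<in> ?T" if "x \<in> ?O" for x
    proof -
      obtain i j where x: "x = (i, j)" by (cases x)
      have "(\<lambda>h. h i * h j) - (\<lambda>h. h i * h i * h j) \<in> ?T"
        using that x assms by (intro fs.subspace_diff T product_in_space square_times_in_space) auto
      then show ?thesis by (simp add: x fun_diff_def)
    qed
    show "(case x of (i, j) \<Rightarrow> \<lambda>h. h i * h j - h i * h i * h j) h = 0" if "x \<in> ?O" "h \<in> ?E2" for x h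
      using that by (auto simp: unit_def indic_def)
    show "(case x of (i, j) \<Rightarrow> \<lambda>h. h i * h j - h i * h i * h j) (?p x) \<noteq> 0" if "x \<in> ?O" for x
      using that by (auto simp: unit_def)
    show "(case x of (i, j) \<Rightarrow> \<lambda>h. h i * h j - h i * h i * h j) (?p y) = 0"
      if "x \<in> ?O" "y \<in> ?O" "x \<noteq> y" for x y
    proof -
      obtain i j i' j' where "x = (i, j)" "y = (i', j')" by (cases x; cases y)
      then show ?thesis using that
        by (cases "i = i'"; cases "i = j'"; cases "j = i'"; cases "j = j'") (auto simp: unit_def)
    qed
  qed (use 2 finP finO in auto)
  \<comment> \<open>All earlier columns have at most two nonzero entries, so products of three
    entries vanish on them.\<close>
  let ?E4 = "?E3 \<union> indic ` ?P 3"
  have 4: "interpolates ?T ?E4 \<and> card ?E4 = card ?E3 + card (?P 3)"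
  proof (intro interpolates_Un[where t = "\<lambda>A h. \<Prod>i\<in>A. h i"] T)
    show "(\<lambda>h. \<Prod>i\<in>A. h i) \<in> ?T" if "A \<in> ?P 3" for A
      using that assms by (intro prod3_in_space) auto
    show "(\<Prod>i\<in>A. h i) = 0" if A: "A \<in> ?P 3" and h: "h \<in> ?E3" for A h
    proof -
      have "(\<Prod>i\<in>A. indic B i) = 0" if "B \<in> ?P 2" for B
        using A that finA[OF A] finA[OF that] by (intro prod_indic_neq) auto
      moreover have "(\<Prod>m\<in>A. (unit 2 i + unit 1 j) m) = 0" for i j
        using out[OF A, of "{i, j}"] finA[OF A]
        by (intro prod_zero) (auto simp: unit_def card_insert_if)
      ultimately show ?thesis using h v1[OF A] by auto
    qed
    show "(\<Prod>i\<in>A. indic A i) \<noteq> 0" if "A \<in> ?P 3" for A by (simp add: indic_def)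
    show "(\<Prod>i\<in>A. indic B i) = 0" if "A \<in> ?P 3" "B \<in> ?P 3" "A \<noteq> B" for A B
      using that finA[OF that(1)] finA[OF that(2)] by (intro prod_indic_neq) auto
  qed (use 3 finP finO in auto)
  have "card ?E4 = k + (k choose 2) + k * (k - 1) + (k choose 3)"
    using 1 2 3 4 n_subsets[of "{..<k}"] card_ordered_pairs[of "{..<k}"] by simp
  moreover have "?E4 \<subseteq> supp_space k"
    by (auto simp: supp_space_def unit_def indic_def subset_eq dest: leD)
  moreover have "finite ?E4" using finP finO by auto
  ultimately show ?thesis using 4 by (intro exI[of _ ?E4]) (simp only: defect_bound_eq)
qed

text \<open>Write x for the product of the column with a. Testing b against 1 and 2 times the i-th
  unit vector gives x^2 = a_i^2 - a_i and a_i^2 = x^2 - x, which forces a_i = 0 over the field with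
  three elements.\<close>

lemma defect_nondegenerate:
  assumes "k \<le> n" and i: "i < k"
    and van: "\<And>b. b \<in> supp_space n \<Longrightarrow> defect n a b (\<lambda>j. if j < k then 2 else 0) = 0"
  shows "a i = 0"
proof -
  let ?h = "\<lambda>j. if j < k then 2 else (0::3)"
  have "carry (dot n ?h a) (2 * c) - 2 * carry (a i) c = 0" for c
    using van[of "unit c i"] assms unit_supp[of i n c] by (simp add: defect_unit)
  from this[of 1] this[of 2] show ?thesis
    by (cases "dot n ?h a" rule: F3_cases; cases "a i" rule: F3_cases) (simp_all add: carry_def)
qed

text \<open>A column supported on the first k positions sees only those entries of the rows.\<close>

lemma defect_degenerate:
  assumes "h \<in> supp_space k" "\<And>i. i < k \<Longrightarrow> a i = 0" shows "defect n a b h = 0"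
proof -
  have z: "h i * a i = 0" for i using assms by (cases "i < k") (auto simp: supp_space_def)
  have "h i * carry (a i) (b i) = 0" for i
    using assms by (cases "i < k") (auto simp: supp_space_def)
  then show ?thesis using z by (simp add: defect_def dot_def carry_fun_apply)
qed

text \<open>The column \<open>?h0\<close> alone forces the first k entries of a to vanish, and
  columns supported there cannot force more. So further columns can be exchanged in from E until
  there are r of them, with the same condition on a.\<close>

lemma exists_defect_columns:
  assumes k: "1 \<le> k" "k \<le> n" and r: "1 \<le> r" "r \<le> defect_bound k"
  shows "\<exists>J. finite J \<and> J \<subseteq> supp_space k \<and> card J = r \<and> interpolates (defect_space n) J
    \<and> (\<forall>a\<in>supp_space n. (\<forall>h\<in>J. \<forall>b\<in>supp_space n. defect n a b h = 0) \<longleftrightarrow> (\<forall>i<k. a i = 0))"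
proof -
  let ?h0 = "\<lambda>j. if j < k then 2 else (0::3)" and ?T = "defect_space n"
  note T = subspace_defect_space[of n]
  obtain E where E: "finite E" "E \<subseteq> supp_space k" "card E = defect_bound k" "interpolates ?T E"
    using exists_interpolated_set[OF k(2)] by auto
  have "\<exists>J. finite J \<and> J \<subseteq> supp_space k \<and> card J = r \<and> interpolates ?T J \<and> ?h0 \<in> J"
    using r
  proof (induction r rule: dec_induct)
    case base
    \<comment> \<open>The first unit vector violates the conclusion of
      \<open>defect_nondegenerate\<close>, so some defect is nonzero at \<open>?h0\<close>; this
      starts the independent family.\<close>
    have "\<not> (\<forall>b\<in>supp_space n. defect n (unit 1 0) b ?h0 = 0)"
      using defect_nondegenerate[of k n 0 "unit 1 0"] k by (auto simp: unit_def)
    then obtain b where "b \<in> supp_space n" "defect n (unit 1 0) b ?h0 \<noteq> 0" by auto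
    then have "interpolates ?T {?h0}"
      using interpolates_insert[OF T interpolates_empty[OF T], of "defect n (unit 1 0) b"] k
      by (simp add: defect_in_space unit_supp)
    then show ?case by (intro exI[of _ "{?h0}"]) (auto simp: supp_space_def)
  next
    case (step m)
    then obtain J where J: "finite J" "J \<subseteq> supp_space k" "card J = m" "interpolates ?T J" "?h0 \<in> J" by auto
    then obtain h where "h \<in> E - J" "interpolates ?T (insert h J)"
      using interpolates_exchange[OF T J(1) E(1) J(4) E(4)] E(3) step by auto
    then show ?case using J E(2) by (intro exI[of _ "insert h J"]) auto
  qed
  then obtain J where J: "finite J" "J \<subseteq> supp_space k" "card J = r" "interpolates ?T J" "?h0 \<in> J" by auto
  have "(\<forall>h\<in>J. \<forall>b\<in>supp_space n. defect n a b h = 0) \<longleftrightarrow> (\<forall>i<k. a i = 0)" for a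
    using J defect_nondegenerate[OF k(2), of _ a] defect_degenerate[of _ k a n] by blast
  then show ?thesis using J by (intro exI[of _ J] conjI ballI)
qed

section \<open>Codes with prescribed columns\<close>

lemma map2_map_self: "map2 f xs (map g xs) = map (\<lambda>x. f x (g x)) xs"
  by (induction xs) auto

lemma vadd_map: "vadd m xs (map g xs) = map (\<lambda>x. (x + g x) mod m) xs"
  by (simp add: vadd_def map2_map_self)

text \<open>As 9 x vanishes modulo m, the inverse of x is 8 x. Closure under addition thus yields
  closure under inverses.\<close>

lemma vneg_eq_multiple:
  assumes "m dvd 9"
  shows "vneg m xs = vadd m xs (vadd m xs (vadd m xs (vadd m xs (vadd m xs (vadd m xs (vadd m xs xs))))))"
proof -
  have "vadd m xs (vadd m xs (vadd m xs (vadd m xs (vadd m xs (vadd m xs (vadd m xs xs))))))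
      = map (\<lambda>x. (8 * x) mod m) xs"
    using vadd_map[of m xs "\<lambda>x. x"] by (simp add: vadd_map mod_simps)
  moreover have "(8 * x) mod m = (- x) mod m" for x
  proof -
    have "m dvd 9 * x" using assms by (rule dvd_mult2)
    then show ?thesis by (simp add: mod_eq_dvd_iff)
  qed
  ultimately show ?thesis by (simp add: vneg_def)
qed

lemma additive_codeI:
  assumes sub: "C \<subseteq> Z3Z9 a b" and zero: "(vzero a, vzero b) \<in> C"
    and closed: "\<And>u v. u \<in> C \<Longrightarrow> v \<in> C \<Longrightarrow> zadd u v \<in> C"
  shows "additive_code a b C"
proof -
  have "zneg u = zadd u (zadd u (zadd u (zadd u (zadd u (zadd u (zadd u u))))))" for u
    by (simp add: zneg_def zadd_def vneg_eq_multiple)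
  then have "zneg u \<in> C" if "u \<in> C" for u using that closed by simp
  then show ?thesis using assms by (simp add: additive_code_def)
qed

definition to_int3 :: "3 \<Rightarrow> int" where
  "to_int3 x = (if x = 0 then 0 else if x = 1 then 1 else 2)"

lemma of_int_to_int3 [simp]: "of_int (to_int3 x) = x"
  by (cases x rule: F3_cases) (simp_all add: to_int3_def)

definition column_sum :: "nat \<Rightarrow> int list \<Rightarrow> (nat \<Rightarrow> 3) \<Rightarrow> int" where
  "column_sum d y h = (\<Sum>i<d. to_int3 (h i) * y ! i)"

lemma of_int_column_sum: "length y = d \<Longrightarrow> of_int (column_sum d y h) = dot d h (lvec y)"
  by (simp add: column_sum_def dot_def lvec_def)

lemma column_sum_vadd:
  assumes "length y = d" "length y' = d"
  shows "column_sum d (vadd 9 y y') h mod 9 = (column_sum d y h mod 9 + column_sum d y' h mod 9) mod 9"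
proof -
  have "column_sum d (vadd 9 y y') h mod 9 = (\<Sum>i<d. to_int3 (h i) * ((y ! i + y' ! i) mod 9)) mod 9"
    using assms by (simp add: column_sum_def vadd_def)
  also have "\<dots> = (\<Sum>i<d. (to_int3 (h i) * ((y ! i + y' ! i) mod 9)) mod 9) mod 9" by (rule mod_sum_eq[symmetric])
  also have "\<dots> = (\<Sum>i<d. (to_int3 (h i) * (y ! i + y' ! i)) mod 9) mod 9" by (simp only: mod_mult_right_eq)
  also have "\<dots> = (\<Sum>i<d. to_int3 (h i) * (y ! i + y' ! i)) mod 9" by (rule mod_sum_eq)
  finally show ?thesis by (simp add: column_sum_def distrib_left sum.distrib mod_simps)
qed

lemma vadd_append:
  "length xs = length xs' \<Longrightarrow> vadd m (xs @ ys) (xs' @ ys') = vadd m xs xs' @ vadd m ys ys'"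
  by (simp add: vadd_def)

section \<open>The code defined by a list of columns\<close>

locale column_code =
  fixes a b g d k :: nat and hs :: "(nat \<Rightarrow> 3) list"
  assumes k_le: "k \<le> a" "k \<le> g" and b_eq: "b = d + (g - k) + length hs"
begin

abbreviation "e \<equiv> d + (g - k)"

text \<open>Of the g coordinates of order 3, the first k go to the ternary part and the other g - k
  become multiples of 3. The d coordinates of order 9 stand in an identity block, and each column of
  \<open>hs\<close> appends one linear combination of them.\<close>

definition gen :: "int list \<times> int list \<Rightarrow> int list \<times> int list" where
  "gen u = (take k (fst u) @ vzero (a - k),
     snd u @ map (\<lambda>t. 3 * t) (drop k (fst u)) @ map (\<lambda>h. column_sum d (snd u) h mod 9) hs)"

lemma gen_in:
  assumes "u \<in> Z3Z9 g d" shows "gen u \<in> Z3Z9 a b"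
proof -
  obtain x y where u: "u = (x, y)" by (cases u)
  have x: "length x = g" "set x \<subseteq> {0..2}" and y: "length y = d" "set y \<subseteq> {0..8}"
    using assms by (auto simp: u Z3Z9_def vecs_def)
  have "set (take k x) \<subseteq> {0..2}" "set (drop k x) \<subseteq> {0..2}"
    using x(2) set_take_subset[of k x] set_drop_subset[of k x] by auto
  moreover have "3 * t \<in> {0..8}" if "t \<in> {0..2}" for t :: int using that by auto
  moreover have "t mod 9 \<in> {0..8}" for t :: int using pos_mod_bound[of 9 t] by simp
  ultimately have "set (take k x) \<subseteq> {0..2}" "(\<lambda>t. 3 * t) ` set (drop k x) \<subseteq> {0..8}"
    "(\<lambda>h. column_sum d y h mod 9) ` set hs \<subseteq> {0..8}" by blast+
  then show ?thesis
    using x y k_le b_eq by (auto simp: u gen_def Z3Z9_def vecs_def vzero_def)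
qed

lemma gen_zadd:
  assumes "u \<in> Z3Z9 g d" "v \<in> Z3Z9 g d" shows "gen (zadd u v) = zadd (gen u) (gen v)"
proof -
  obtain x y x' y' where u: "u = (x, y)" and v: "v = (x', y')" by (cases u; cases v)
  have len: "length x = g" "length x' = g" "length y = d" "length y' = d"
    using assms by (auto simp: u v Z3Z9_def vecs_def)
  have "take k (vadd 3 x x') = vadd 3 (take k x) (take k x')"
    by (simp add: vadd_def take_map take_zip)
  moreover have "vadd 3 (vzero (a - k)) (vzero (a - k)) = vzero (a - k)"
    by (simp add: vadd_def vzero_def zip_replicate)
  moreover have "map (\<lambda>t. 3 * t) (drop k (vadd 3 x x'))
      = vadd 9 (map (\<lambda>t. 3 * t) (drop k x)) (map (\<lambda>t. 3 * t) (drop k x'))"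
  proof -
    have "3 * ((s + t) mod 3) = (3 * s + 3 * t) mod 9" for s t :: int
      using mult_mod_right[of 3 "s + t" 3] by (simp add: distrib_left)
    then show ?thesis by (simp add: vadd_def drop_map drop_zip zip_map1 zip_map2 case_prod_beta comp_def)
  qed
  moreover have "map (\<lambda>h. column_sum d (vadd 9 y y') h mod 9) hs
      = vadd 9 (map (\<lambda>h. column_sum d y h mod 9) hs) (map (\<lambda>h. column_sum d y' h mod 9) hs)"
    using len column_sum_vadd[of y d y']
    by (simp add: vadd_def[of 9 "map _ _"] zip_map1 zip_map2 zip_same_conv_map comp_def)
  ultimately show ?thesis
    using len by (simp add: u v gen_def zadd_def vadd_append)
qed

lemma inj_on_gen: "inj_on gen (Z3Z9 g d)"
proof (rule inj_onI)
  fix u v assume uv: "u \<in> Z3Z9 g d" "v \<in> Z3Z9 g d" and eq: "gen u = gen v"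
  have len: "length (fst u) = g" "length (fst v) = g" "length (snd u) = d" "length (snd v) = d"
    using uv by (auto simp: Z3Z9_def vecs_def)
  have 1: "take k (fst u) = take k (fst v)" "snd u = snd v"
    "map (\<lambda>t. 3 * t) (drop k (fst u)) = map (\<lambda>t. 3 * t) (drop k (fst v))"
    using eq len by (auto simp: gen_def)
  moreover have "drop k (fst u) = drop k (fst v)"
    using 1(3) by (rule map_injective) (auto intro: injI)
  ultimately show "u = v" by (metis append_take_drop_id prod_eq_iff)
qed

definition "C = gen ` Z3Z9 g d"

lemma additive_C: "additive_code a b C"
proof (rule additive_codeI)
  show "C \<subseteq> Z3Z9 a b" using gen_in by (auto simp: C_def)
  have "gen (vzero g, vzero d) = (vzero a, vzero b)"
  proof -
    have "column_sum d (vzero d) h = 0" for h by (simp add: column_sum_def vzero_def)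
    then have "map (\<lambda>h. column_sum d (vzero d) h mod 9) hs = vzero (length hs)"
      by (simp add: vzero_def map_replicate_const)
    moreover have "take k (vzero g) @ vzero (a - k) = vzero a"
      using k_le by (simp add: vzero_def flip: replicate_add)
    moreover have "vzero d @ map (\<lambda>t. 3 * t) (drop k (vzero g)) @ vzero (length hs) = vzero b"
      using b_eq by (simp add: vzero_def flip: replicate_add)
    ultimately show ?thesis by (simp add: gen_def)
  qed
  then show "(vzero a, vzero b) \<in> C" using zero_in_Z3Z9 by (force simp: C_def)
  fix u v assume "u \<in> C" "v \<in> C"
  then obtain x y where "x \<in> Z3Z9 g d" "y \<in> Z3Z9 g d" "u = gen x" "v = gen y" by (auto simp: C_def)
  then show "zadd u v \<in> C" 
    unfolding C_def using gen_zadd[of x y] zadd_in_Z3Z9[of x g d y] by (metis imageI)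
qed

lemma length_hs: "length hs = b - e" and e_le: "e \<le> b"
  using b_eq by auto

definition first :: "(nat \<Rightarrow> 3) \<Rightarrow> nat \<Rightarrow> 3" where
  "first x i = (if i < k then x i else 0)"

text \<open>One shape serves both digits of the Z_9 part: with m = 0 it gives the residues, and for
  words of residue 0 it gives the digits q.\<close>

definition row :: "(nat \<Rightarrow> 3) \<Rightarrow> (nat \<Rightarrow> 3) \<Rightarrow> nat \<Rightarrow> 3" where
  "row m y i = (if i < d then y i else if i < e then m (i - d)
     else if i < b then dot d (hs ! (i - e)) y else 0)"

lemma row_last:
  assumes "j < length hs" shows "row m y (e + j) = dot d (hs ! j) y"
proof -
  have "e + j < b" using assms length_hs e_le by linarith
  then show ?thesis by (simp add: row_def)
qed

lemma coords_gen:
  assumes "u \<in> Z3Z9 g d" and c: "coords u = (x, q, r)"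
  shows "fst (coords (gen u)) = first x" and "snd (snd (coords (gen u))) = row 0 r"
    and "r = 0 \<Longrightarrow> fst (snd (coords (gen u))) = row (\<lambda>i. x (k + i)) q"
proof -
  obtain xs ys where u: "u = (xs, ys)" by (cases u)
  have len: "length xs = g" "length ys = d" using assms by (auto simp: u Z3Z9_def vecs_def)
  have x: "x = lvec xs" and q: "q = lvec (map (\<lambda>t. t div 3) ys)" and r: "r = lvec ys"
    using c by (auto simp: coords_def u)
  show "fst (coords (gen u)) = first x"
  proof
    fix i show "fst (coords (gen u)) i = first x i"
      using len k_le by (auto simp: coords_def gen_def u x first_def lvec_def nth_append vzero_def)
  qed
  show "snd (snd (coords (gen u))) = row 0 r"
  proof
    fix i
    consider "i < d" | "d \<le> i" "i < e" | "e \<le> i" "i < b" | "b \<le> i" by linarith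
    then show "snd (snd (coords (gen u))) i = row 0 r i"
    proof cases
      case 3
      then have "i - d - (g - k) = i - e" "i - e < length hs" "\<not> i - d < g - k" using length_hs e_le by auto
      then show ?thesis
        using 3 len length_hs e_le of_int_column_sum[of ys d "hs ! (i - e)"]
        by (simp add: coords_def gen_def u r row_def lvec_def nth_append of_int_F3_mod)
    next
      case 2
      have "(of_int (3 * t) :: 3) = of_int 0" for t by (simp only: of_int_F3_eq) simp
      moreover have "i - d < g - k" "\<not> i < d" using 2 by auto
      ultimately show ?thesis using 2 len
        by (simp add: coords_def gen_def u r row_def lvec_def nth_append del: of_int_mult)
    qed (use len length_hs e_le in \<open>auto simp: coords_def gen_def u r row_def lvec_def nth_append\<close>)
  qed
  assume r0: "r = 0"
  \<comment> \<open>All entries are multiples of 3 here, so the column sums can be divided by 3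
    without carries.\<close>
  have y3: "ys ! i = 3 * (ys ! i div 3)" if "i < d" for i
  proof -
    have "(of_int (ys ! i) :: 3) = of_int 0" using fun_cong[OF r0, of i] that len by (simp add: r lvec_def)
    then have "ys ! i mod 3 = 0" by (simp only: of_int_F3_eq) simp
    then show ?thesis by presburger
  qed
  have col: "of_int ((column_sum d ys h mod 9) div 3) = dot d h q" for h
  proof -
    let ?z = "column_sum d (map (\<lambda>t. t div 3) ys) h"
    have "column_sum d ys h = (\<Sum>i<d. 3 * (to_int3 (h i) * (ys ! i div 3)))"
      unfolding column_sum_def by (intro sum.cong refl) (metis y3 lessThan_iff mult.left_commute)
    also have "\<dots> = 3 * ?z" using len by (simp add: column_sum_def sum_distrib_left)
    finally have "(column_sum d ys h mod 9) div 3 = ?z mod 3"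
      using mult_mod_right[of 3 ?z 3] by simp
    then show ?thesis using len by (simp add: of_int_F3_mod of_int_column_sum q)
  qed
  show "fst (snd (coords (gen u))) = row (\<lambda>i. x (k + i)) q"
  proof
    fix i
    consider "i < d" | "d \<le> i" "i < e" | "e \<le> i" "i < b" | "b \<le> i" by linarith
    then show "fst (snd (coords (gen u))) i = row (\<lambda>i. x (k + i)) q i"
    proof cases
      case 2
      moreover from this have "i - d < g - k" "\<not> i < d" "k + (i - d) < g"
        "i < d + (g - k + length hs)" by auto
      ultimately show ?thesis using len
        by (simp add: coords_def gen_def u x row_def lvec_def nth_append)
    next
      case 3
      then have "i - d - (g - k) = i - e" "i - e < length hs" "\<not> i - d < g - k" using length_hs e_le by auto
      then show ?thesis
        using 3 len length_hs e_le col[of "hs ! (i - e)"]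
        by (simp add: coords_def gen_def u row_def lvec_def nth_append)
    qed (use len length_hs e_le in \<open>auto simp: coords_def gen_def u q row_def lvec_def nth_append\<close>)
  qed
qed

sublocale tw: twisted_code a b "coords ` C"
  by (rule additive_code_twisted[OF additive_C])

lemma coords_surj:
  assumes "x \<in> supp_space g" "q \<in> supp_space d" "r \<in> supp_space d"
  obtains u where "u \<in> Z3Z9 g d" "coords u = (x, q, r)"
proof -
  have "(x, q, r) \<in> coords ` Z3Z9 g d" using assms by (simp add: coords_image)
  then show thesis using that by auto
qed

lemma row_zero:
  assumes "row 0 r = 0" "r \<in> supp_space d" shows "r = 0"
proof
  fix i show "r i = 0 i"
    using fun_cong[OF assms(1), of i] assms(2) by (cases "i < d") (auto simp: row_def supp_space_def)
qed

lemma R_eq: "tw.R = row 0 ` supp_space d"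
proof (intro equalityI subsetI)
  fix r assume "r \<in> tw.R"
  then obtain x q u where u: "u \<in> Z3Z9 g d" and c: "(x, q, r) = coords (gen u)"
    by (auto simp: residue_part_def C_def)
  have "r = snd (snd (coords (gen u)))" by (simp flip: c)
  then show "r \<in> row 0 ` supp_space d"
    using coords_gen(2)[OF u] coords_supp[OF u] by (cases "coords u") auto
next
  fix r assume "r \<in> row 0 ` supp_space d"
  then obtain y where y: "y \<in> supp_space d" "r = row 0 y" by auto
  obtain u where u: "u \<in> Z3Z9 g d" "coords u = (0, 0, y)"
    using coords_surj[of 0 0 y] y fs.subspace_0[OF subspace_supp_space] by metis
  then have "snd (snd (coords (gen u))) = r" using coords_gen(2)[OF u] y by simp
  moreover have "coords (gen u) \<in> coords ` C" using u by (auto simp: C_def)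
  ultimately show "r \<in> tw.R" unfolding residue_part_def by (metis (mono_tags, lifting) mem_Collect_eq prod.collapse)
qed

lemma A_eq: "tw.A = supp_space k"
proof (intro equalityI subsetI)
  fix x assume "x \<in> tw.A"
  then obtain q u where "u \<in> Z3Z9 g d" "(x, q, 0) = coords (gen u)" by (auto simp: first_part_def C_def)
  then have "x = first (fst (coords u))"
    using coords_gen(1)[of u] by (metis fst_conv prod.collapse)
  then show "x \<in> supp_space k" by (simp add: supp_space_def first_def)
next
  fix x assume x: "x \<in> supp_space k"
  then have "x \<in> supp_space g" using k_le by (auto simp: supp_space_def)
  then obtain u where u: "u \<in> Z3Z9 g d" "coords u = (x, 0, 0)"
    using coords_surj[of x 0 0] fs.subspace_0[OF subspace_supp_space] by metis
  have "first x = x" using x by (auto simp: first_def supp_space_def fun_eq_iff)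
  moreover have "row 0 0 = 0" by (auto simp: row_def dot_zero fun_eq_iff)
  ultimately have "coords (gen u) = (x, fst (snd (coords (gen u))), 0)"
    using coords_gen(1,2)[OF u] by (metis prod.collapse)
  moreover have "coords (gen u) \<in> coords ` C" using u by (auto simp: C_def)
  ultimately show "x \<in> tw.A" unfolding first_part_def by (metis (mono_tags, lifting) mem_Collect_eq)
qed

lemma has_type_C: "has_type C a b g d k"
proof -
  have "(3::nat) ^ k = 3 ^ dim3 a (fst ` {u\<in>C. zadd u (zadd u u) = (vzero a, vzero b)})"
    using card_first_part_eq_dim3[OF additive_C] by (simp add: A_eq card_supp_space)
  then have "k = dim3 a (fst ` {u\<in>C. zadd u (zadd u u) = (vzero a, vzero b)})" by simp
  moreover have "bij_betw gen (Z3Z9 g d) C" using inj_on_gen by (simp add: C_def bij_betw_def)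
  ultimately show ?thesis using additive_C gen_zadd unfolding has_type_def by blast
qed

text \<open>The parity checks of the appended columns. Within \<open>supp_space b\<close> their
  kernel is \<open>D\<close>, so they describe vectors modulo \<open>D\<close>.\<close>

definition parity :: "(nat \<Rightarrow> 3) \<Rightarrow> nat \<Rightarrow> 3" where
  "parity q j = (if j < length hs then q (e + j) - dot d (hs ! j) q else 0)"

lemma dot_cong: "(\<And>i. i < d \<Longrightarrow> y i = y' i) \<Longrightarrow> dot d h y = dot d h y'"
  by (simp add: dot_def)

lemma parity_row: "parity (row m y) = 0"
proof
  fix j
  have "dot d h (row m y) = dot d h y" for h by (rule dot_cong) (simp add: row_def)
  then show "parity (row m y) j = 0 j" by (simp add: parity_def row_last)
qed

lemma D_eq: "tw.D = {q \<in> supp_space b. parity q = 0}"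
proof (intro equalityI subsetI)
  fix q assume q: "q \<in> tw.D"
  then obtain u where u: "u \<in> Z3Z9 g d" "coords (gen u) = (0, q, 0)" by (auto simp: low_part_def C_def)
  obtain x q' r where c: "coords u = (x, q', r)" by (cases "coords u")
  have "row 0 r = 0" using coords_gen(2)[OF u(1) c] u(2) by simp
  moreover have "r \<in> supp_space d" using coords_supp[OF u(1)] c by simp
  ultimately have "r = 0" by (rule row_zero)
  then have "q = row (\<lambda>i. x (k + i)) q'" using coords_gen(3)[OF u(1) c] u(2) by simp
  then show "q \<in> {q \<in> supp_space b. parity q = 0}" using q tw.D_supp parity_row by auto
next
  fix q assume "q \<in> {q \<in> supp_space b. parity q = 0}"
  then have q: "q \<in> supp_space b" "parity q = 0" by auto
  define x where "x = (\<lambda>i. if k \<le> i \<and> i < g then q (d + (i - k)) else 0)"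
  define q' where "q' = (\<lambda>i. if i < d then q i else 0)"
  have "x \<in> supp_space g" "q' \<in> supp_space d" by (auto simp: x_def q'_def supp_space_def)
  then obtain u where u: "u \<in> Z3Z9 g d" "coords u = (x, q', 0)"
    using coords_surj[of x q' 0] fs.subspace_0[OF subspace_supp_space] by metis
  have "first x = 0" by (auto simp: first_def x_def fun_eq_iff)
  moreover have "row 0 0 = 0" by (auto simp: row_def dot_zero fun_eq_iff)
  moreover have "row (\<lambda>i. x (k + i)) q' = q"
  proof
    fix i
    have dq: "dot d h q' = dot d h q" for h by (rule dot_cong) (simp add: q'_def)
    consider "i < d" | "d \<le> i" "i < e" | "e \<le> i" "i < b" | "b \<le> i" by linarith
    then show "row (\<lambda>i. x (k + i)) q' i = q i"
    proof cases
      case 3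
      then have "i - e < length hs" using length_hs by linarith
      then have "parity q (i - e) = q i - dot d (hs ! (i - e)) q" using 3 by (simp add: parity_def)
      then show ?thesis using 3 q(2) dq by (simp add: row_def)
    next
      case 4
      then show ?thesis using q(1) length_hs e_le by (simp add: row_def supp_space_def)
    qed (auto simp: row_def x_def q'_def)
  qed
  ultimately have "coords (gen u) = (0, q, 0)" using coords_gen[OF u] by (simp add: prod_eq_iff)
  then show "q \<in> tw.D" using u(1) unfolding low_part_def C_def by force
qed

text \<open>The first d entries of \<open>row 0 y\<close> are those of y, so the check of a column
  on a carry is the defect of that column.\<close>

lemma parity_carry: "parity (carry (row 0 y) (row 0 z)) j
    = (if j < length hs then defect d y z (hs ! j) else 0)"
proof -
  have "dot d h (carry (row 0 y) (row 0 z)) = dot d h (carry y z)" for h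
    by (rule dot_cong) (simp add: row_def carry_fun_apply)
  then show ?thesis by (simp add: parity_def defect_def carry_fun_apply row_last)
qed

lemma parity_add: "parity (p + q) = parity p + parity q"
  by (rule ext) (simp add: parity_def dot_add)

lemma inj_on_row: "inj_on (row 0) (supp_space d)"
proof (rule inj_onI)
  fix y z assume yz: "y \<in> supp_space d" "z \<in> supp_space d" "row 0 y = row 0 z"
  have "y i = z i" for i
    using fun_cong[OF yz(3), of i] yz(1,2) by (cases "i < d") (auto simp: row_def supp_space_def)
  then show "y = z" by auto
qed

lemma carry_in_D_iff:
  assumes "y \<in> supp_space d" "z \<in> supp_space d"
  shows "carry (row 0 z) (row 0 y) \<in> tw.D \<longleftrightarrow> (\<forall>h\<in>set hs. defect d y z h = 0)"
proof -
  have "row 0 z \<in> supp_space b" using R_eq assms tw.R_supp by blast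
  then have "carry (row 0 z) (row 0 y) \<in> tw.D \<longleftrightarrow> parity (carry (row 0 y) (row 0 z)) = 0"
    by (simp add: D_eq carry_supp_space carry_commute[of "row 0 y"])
  also have "\<dots> \<longleftrightarrow> (\<forall>j<length hs. defect d y z (hs ! j) = 0)"
    by (auto simp: fun_eq_iff parity_carry)
  finally show ?thesis by (simp only: all_set_conv_all_nth)
qed

text \<open>By \<open>deg\<close> the set \<open>KR\<close> consists of the rows of those y whose
  first n entries vanish; this is the kernel of truncation to n entries.\<close>

lemma card_R_eq:
  assumes "n \<le> d"
    and deg: "\<And>y. y \<in> supp_space d \<Longrightarrow>
      (\<forall>h\<in>set hs. \<forall>z\<in>supp_space d. defect d y z h = 0) \<longleftrightarrow> (\<forall>i<n. y i = 0)"
  shows "card tw.R = 3 ^ n * card tw.KR"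
proof -
  let ?Z = "{y\<in>supp_space d. \<forall>i<n. y i = 0}" and ?f = "\<lambda>y i. if i < n then y i else (0::3)"
  have "tw.KR = row 0 ` {y\<in>supp_space d. \<forall>z\<in>supp_space d. \<forall>h\<in>set hs. defect d y z h = 0}"
    unfolding tw.KR_def R_eq using carry_in_D_iff by auto
  also have "{y\<in>supp_space d. \<forall>z\<in>supp_space d. \<forall>h\<in>set hs. defect d y z h = 0} = ?Z" using deg by blast
  finally have "card tw.KR = card ?Z"
    using card_image[OF inj_on_subset[OF inj_on_row, of ?Z]] by (simp only: mem_Collect_eq Collect_subset)
  moreover have "card (supp_space d) = card {y\<in>supp_space d. ?f y = 0} * card (?f ` supp_space d)"
    by (intro card_hom_subspace finite_supp_space subspace_supp_space) auto
  moreover have "{y\<in>supp_space d. ?f y = 0} = ?Z" by (auto simp: fun_eq_iff)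
  moreover have "?f ` supp_space d = supp_space n"
  proof (intro equalityI subsetI)
    fix f assume f: "f \<in> supp_space n"
    then have "f \<in> supp_space d" "?f f = f" using assms(1) by (auto simp: supp_space_def fun_eq_iff)
    then show "f \<in> ?f ` supp_space d" by (intro image_eqI[of _ _ f]) simp_all
  qed (auto simp: supp_space_def)
  moreover have "card tw.R = card (supp_space d)" using inj_on_row by (simp add: R_eq card_image)
  ultimately show ?thesis by (simp add: card_supp_space)
qed

text \<open>The parity checks map \<open>S\<close> onto the vectors supported on the positions of
  \<open>js\<close>, with kernel \<open>D\<close>. The zero columns used as padding have no
  defect.\<close>

lemma card_S_eq:
  assumes hs: "hs = js @ replicate m 0" "distinct js"
    and int: "interpolates (defect_space d) (set js)"
  shows "card tw.S = 3 ^ length js * card tw.D"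
proof -
  have pzero: "parity 0 = 0" by (simp add: fun_eq_iff parity_def dot_zero)
  have nth0: "hs ! j = 0" if "length js \<le> j" "j < length hs" for j
    using that hs(1) by (auto simp: nth_append)
  have gen: "parity c \<in> supp_space (length js)" if "c \<in> tw.D \<union> tw.carries" for c
    using that
  proof
    assume "c \<in> tw.D" then show ?thesis by (simp add: D_eq fs.subspace_0)
  next
    assume "c \<in> tw.carries"
    then obtain y z where "c = carry (row 0 y) (row 0 z)" by (auto simp: tw.carries_def R_eq)
    then show ?thesis
      using nth0 by (auto simp: supp_space_def parity_carry defect_def dot_zero)
  qed
  have "fs.subspace {c. parity c \<in> supp_space (length js)}"
    unfolding subspace_iff
    using pzero fs.subspace_0[OF subspace_supp_space] fs.subspace_add[OF subspace_supp_space]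
    by (auto simp: parity_add)
  then have "tw.S \<subseteq> {c. parity c \<in> supp_space (length js)}"
    unfolding tw.S_def using gen by (intro fs.span_minimal) auto
  then have "parity ` tw.S \<subseteq> supp_space (length js)" by auto
  moreover have "supp_space (length js) \<subseteq> parity ` tw.S"
  proof
    fix f assume f: "f \<in> supp_space (length js)"
    \<comment> \<open>The prescribed value at a column is the entry of f at its index, which is well
      defined as \<open>js\<close> is distinct.\<close>
    define \<phi> where "\<phi> h = f (inv_into {..<length js} ((!) js) h)" for h
    obtain t where t: "t \<in> defect_space d" "\<And>h. h \<in> set js \<Longrightarrow> t h = \<phi> h"
      using int unfolding interpolates_def by blast
    let ?ev = "\<lambda>t :: (nat \<Rightarrow> 3) \<Rightarrow> 3. \<lambda>j. if j < length hs then t (hs ! j) else 0"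
    \<comment> \<open>The condition \<open>t 0 = 0\<close> is carried along to control the values at
      the padding columns.\<close>
    have "fs.subspace {t. ?ev t \<in> parity ` tw.S \<and> t 0 = 0}"
      unfolding subspace_iff
    proof (intro conjI ballI)
      have "?ev 0 = parity 0" by (simp add: pzero) auto
      then show "0 \<in> {t. ?ev t \<in> parity ` tw.S \<and> t 0 = 0}"
        using fs.subspace_0[OF tw.subspace_S] by auto
      fix s t assume "s \<in> {t. ?ev t \<in> parity ` tw.S \<and> t 0 = 0}" "t \<in> {t. ?ev t \<in> parity ` tw.S \<and> t 0 = 0}"
      then obtain c c' where "c \<in> tw.S" "c' \<in> tw.S" "?ev s = parity c" "?ev t = parity c'" "s 0 = 0" "t 0 = 0"
        by auto
      moreover have "?ev (s + t) = ?ev s + ?ev t" by (rule ext) simp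
      ultimately have "?ev (s + t) = parity (c + c')" "c + c' \<in> tw.S" "(s + t) 0 = 0"
        using fs.subspace_add[OF tw.subspace_S] by (simp_all add: parity_add)
      then show "s + t \<in> {t. ?ev t \<in> parity ` tw.S \<and> t 0 = 0}" by blast
    qed
    moreover have "defect d y z \<in> {t. ?ev t \<in> parity ` tw.S \<and> t 0 = 0}"
      if "y \<in> supp_space d" "z \<in> supp_space d" for y z
    proof -
      have "carry (row 0 y) (row 0 z) \<in> tw.S"
        using that tw.carries_subset_S by (auto simp: tw.carries_def R_eq)
      moreover have "?ev (defect d y z) = parity (carry (row 0 y) (row 0 z))"
        by (simp add: fun_eq_iff parity_carry)
      ultimately show ?thesis by (auto simp: defect_def dot_zero)
    qed
    ultimately have "defect_space d \<subseteq> {t. ?ev t \<in> parity ` tw.S \<and> t 0 = 0}"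
      unfolding defect_space_def by (intro fs.span_minimal) auto
    then have ev: "?ev t \<in> parity ` tw.S" "t 0 = 0" using t(1) by auto
    have "?ev t = f"
    proof
      fix j show "?ev t j = f j"
      proof (cases "j < length js")
        case True
        then have "hs ! j = js ! j" "j < length hs" "js ! j \<in> set js" using hs(1) by (auto simp: nth_append)
        moreover have "inv_into {..<length js} ((!) js) (js ! j) = j"
          using True hs(2) by (intro inv_into_f_f) (auto simp: inj_on_nth)
        ultimately show ?thesis using t(2)[of "js ! j"] by (simp add: \<phi>_def)
      next
        case False
        then show ?thesis using f ev(2) nth0[of j] by (auto simp: supp_space_def)
      qed
    qed
    then show "f \<in> parity ` tw.S" using ev(1) by simp
  qed
  ultimately have img: "parity ` tw.S = supp_space (length js)" by blast
  have "{c\<in>tw.S. parity c = 0} = tw.D" using tw.D_subset_S tw.S_supp by (auto simp: D_eq)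
  moreover have "card tw.S = card {c\<in>tw.S. parity c = 0} * card (parity ` tw.S)"
    using finite_subset[OF tw.S_supp finite_supp_space] tw.subspace_S parity_add
    by (intro card_hom_subspace)
  ultimately show ?thesis by (simp add: img card_supp_space)
qed

end

section \<open>Necessary conditions and realisation of all values\<close>

lemma rank_kernel_defect_bounds:
  assumes type: "has_type C a b g d k"
    and ker: "int (ker3 (a + 3 * b) (Gray ` C)) = int g + 2 * int d - int kb"
    and rank: "int (rank3 (a + 3 * b) (Gray ` C)) = int g + 2 * int d + int rb"
  shows "(kb = 0 \<longleftrightarrow> rb = 0) \<and> kb \<le> d \<and> rb + g + d \<le> b + k \<and> rb \<le> defect_bound kb"
proof -
  have code: "additive_code a b C" using type by (simp add: has_type_def)
  interpret tw: twisted_code a b "coords ` C" by (rule additive_code_twisted[OF code])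
  have R: "card tw.R = 3 ^ kb * card tw.KR" using ker3_iff[OF type, THEN iffD1, OF ker] .
  have S: "card tw.S = 3 ^ rb * card tw.D" using rank3_iff[OF type, THEN iffD1, OF rank] .
  have D0: "0 < card tw.D" by (rule card_low_part_pos[OF type])
  have K0: "0 < card tw.KR"
  proof -
    have "finite tw.KR" using tw.finite_R by (auto simp: tw.KR_def)
    then show ?thesis using fs.subspace_0[OF tw.subspace_KR] by (auto simp: card_gt_0_iff)
  qed
  have KR: "tw.KR \<subseteq> tw.R" by (auto simp: tw.KR_def)
  have finS: "finite tw.S" using tw.S_supp finite_supp_space finite_subset by blast
  have "kb = 0 \<longleftrightarrow> card tw.KR = card tw.R" using R K0 by (cases kb) auto
  also have "\<dots> \<longleftrightarrow> tw.KR = tw.R" using card_subset_eq[OF tw.finite_R KR] by auto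
  also have "\<dots> \<longleftrightarrow> tw.S = tw.D" using tw.S_eq_D_iff by simp
  also have "\<dots> \<longleftrightarrow> card tw.D = card tw.S" using card_subset_eq[OF finS tw.D_subset_S] by auto
  also have "\<dots> \<longleftrightarrow> rb = 0" using S D0 by (cases rb) auto
  finally have 1: "kb = 0 \<longleftrightarrow> rb = 0" .
  have "3 ^ kb * 1 \<le> 3 ^ kb * card tw.KR" using K0 by (intro mult_le_mono2) simp
  then have "(3::nat) ^ kb \<le> 3 ^ d" using R card_residue_part[OF type] by simp
  then have 2: "kb \<le> d" by simp
  \<comment> \<open>The space \<open>S\<close> lies in dimension b, while \<open>D\<close> has
    dimension g + d - k; this bounds the rank excess by the length.\<close>
  have "card tw.S \<le> 3 ^ b" using card_mono[OF finite_supp_space tw.S_supp] by (simp add: card_supp_space)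
  then have "3 ^ rb * (card tw.D * 3 ^ k) \<le> 3 ^ b * 3 ^ k" using S by (simp add: mult.assoc)
  then have "(3::nat) ^ (rb + (g + d)) \<le> 3 ^ (b + k)"
    unfolding card_low_part[OF type] by (simp only: power_add)
  then have 3: "rb + g + d \<le> b + k" by simp
  have "card tw.D * 3 ^ rb \<le> card tw.D * 3 ^ defect_bound kb"
    using tw.card_S_le[OF R] S by (simp add: mult.commute)
  then have "rb \<le> defect_bound kb" using D0 by simp
  with 1 2 3 show ?thesis by blast
qed

lemma exists_code_with_defects:
  assumes dims: "k \<le> a" "k \<le> g" "rb + g + d \<le> b + k"
    and r: "kb = 0 \<and> rb = 0 \<or> 1 \<le> kb \<and> kb \<le> d \<and> 1 \<le> rb \<and> rb \<le> defect_bound kb"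
  shows "\<exists>C. has_type C a b g d k \<and>
    int (ker3 (a + 3 * b) (Gray ` C)) = int g + 2 * int d - int kb \<and>
    int (rank3 (a + 3 * b) (Gray ` C)) = int g + 2 * int d + int rb"
proof -
  obtain J where J: "finite J" "card J = rb" "interpolates (defect_space d) J"
    "\<And>y. y \<in> supp_space d \<Longrightarrow>
      (\<forall>h\<in>J. \<forall>z\<in>supp_space d. defect d y z h = 0) \<longleftrightarrow> (\<forall>i<kb. y i = 0)"
  proof (cases "kb = 0")
    case True
    then show thesis using r that[of "{}"] interpolates_empty[OF subspace_defect_space] by auto
  next
    case False
    then show thesis using r that exists_defect_columns[of kb d rb] by auto
  qed
  obtain js where js: "set js = J" "distinct js" using finite_distinct_list[OF J(1)] by blast
  have len: "length js = rb" using js J(2) distinct_card by metis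
  \<comment> \<open>The columns must fill the length b exactly; the positions left over receive zero
    columns, which affect neither kernel defect nor rank excess.\<close>
  define m where "m = b - (d + (g - k)) - rb"
  define hs where "hs = js @ replicate m (0 :: nat \<Rightarrow> 3)"
  interpret column_code a b g d k hs
    using dims len by unfold_locales (simp_all add: hs_def m_def)
  have "defect d y z 0 = 0" for y z by (simp add: defect_def dot_zero)
  then have "(\<forall>h\<in>set hs. \<forall>z\<in>supp_space d. defect d y z h = 0) \<longleftrightarrow> (\<forall>i<kb. y i = 0)"
    if "y \<in> supp_space d" for y
    using J(4)[OF that] js(1) by (auto simp: hs_def)
  then have "card tw.R = 3 ^ kb * card tw.KR" using r by (intro card_R_eq) auto
  moreover have "card tw.S = 3 ^ rb * card tw.D"
    using card_S_eq[OF hs_def js(2)] J(3) js(1) len by simp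
  ultimately show ?thesis
    using has_type_C ker3_iff[OF has_type_C] rank3_iff[OF has_type_C] by blast
qed

theorem theorem17:
  fixes \<alpha> \<beta> \<gamma> \<delta> \<kappa> kb rb :: nat
  assumes "0 < \<alpha>" "0 < \<beta>" "0 < \<gamma>" "0 < \<delta>" "0 < \<kappa>"
    and "0 < \<gamma> + \<delta>" "\<gamma> + \<delta> \<le> \<beta> + \<kappa>"
    and "\<kappa> \<le> min \<alpha> \<gamma>"
  shows "(\<exists>\<C>. has_type \<C> \<alpha> \<beta> \<gamma> \<delta> \<kappa> \<and>
            int (ker3 (\<alpha> + 3 * \<beta>) (Gray ` \<C>)) = int \<gamma> + 2 * int \<delta> - int kb \<and>
            int (rank3 (\<alpha> + 3 * \<beta>) (Gray ` \<C>)) = int \<gamma> + 2 * int \<delta> + int rb)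
     \<longleftrightarrow> ((kb = 0 \<and> rb = 0) \<or>
          (1 \<le> kb \<and> kb \<le> \<delta> \<and> 1 \<le> rb \<and>
           int rb \<le> min (int \<beta> - (int \<gamma> - int \<kappa>) - int \<delta>)
                        (int (kb choose 2) + int ((kb + 2) choose 3))))"
proof -
  let ?code = "\<exists>\<C>. has_type \<C> \<alpha> \<beta> \<gamma> \<delta> \<kappa> \<and>
            int (ker3 (\<alpha> + 3 * \<beta>) (Gray ` \<C>)) = int \<gamma> + 2 * int \<delta> - int kb \<and>
            int (rank3 (\<alpha> + 3 * \<beta>) (Gray ` \<C>)) = int \<gamma> + 2 * int \<delta> + int rb"
  have bound: "int rb \<le> min (int \<beta> - (int \<gamma> - int \<kappa>) - int \<delta>) (int (kb choose 2) + int ((kb + 2) choose 3))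
      \<longleftrightarrow> rb + \<gamma> + \<delta> \<le> \<beta> + \<kappa> \<and> rb \<le> defect_bound kb"
    unfolding defect_bound_def by linarith
  have "?code \<Longrightarrow> (kb = 0 \<longleftrightarrow> rb = 0) \<and> kb \<le> \<delta> \<and> rb + \<gamma> + \<delta> \<le> \<beta> + \<kappa> \<and> rb \<le> defect_bound kb"
    using rank_kernel_defect_bounds by blast
  moreover have "kb = 0 \<and> rb = 0 \<or> 1 \<le> kb \<and> kb \<le> \<delta> \<and> 1 \<le> rb \<and> rb \<le> defect_bound kb
      \<Longrightarrow> rb + \<gamma> + \<delta> \<le> \<beta> + \<kappa> \<Longrightarrow> ?code"
    using assms(8) by (intro exists_code_with_defects) auto
  \<comment> \<open>Without defects the length condition is the assumed inequality for the
    type.\<close>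
  moreover have "kb = 0 \<and> rb = 0 \<Longrightarrow> rb + \<gamma> + \<delta> \<le> \<beta> + \<kappa>" using assms(7) by simp
  moreover have "1 \<le> n \<longleftrightarrow> n \<noteq> 0" for n :: nat by auto
  ultimately show ?thesis unfolding bound by blast
qed

end
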